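(* Let $G$ be a countable discrete amenable group and $\{X_g\}_{g\in G}$ a finite-valued ergodic $G$-process with entropy $h$. Let $\{F_n\}$ be a tempered Følner sequence in $G$ with $|F_n|\ge n$. If $\{W_n\}$ is a filling sequence, then almost surely \[ U^*=\limsup_{k\to\infty}\sup_n-\frac{1}{|F_k|}\log U_{k,n}^{(F,W)}\le h. \]
   Context: Setting: $\Sigma$ finite, $(\Omega,\mathcal F,P)$ a standard probability space with an ergodic measure-preserving free left $G$-action, $x(g)=X(gx)$ for measurable $X:\Omega\to\Sigma$; $h=\lim_k\frac1{|F_k|}H(\{X_g\}_{g\in F_k})$; logs base 2. $[x(E)]=\{x':x'(f)=x(f)\ \forall f\in E\}$. Tempered Følner: $|F_n\triangle gF_n|/|F_n|\to0$ for all $g$ and $|(\bigcup_{k<n}F_k^{-1})F_n|\le C|F_n|$. $x(F_k)$ repeats at $f$ if $fx\in[x(F_k)]$. Define $U_{k,n}^{(F,W)}(x)=\frac{1}{|W_n|}\max\{|E|: 1_G\in E\subseteq W_n,\ \{F_kf\}_{f\in E}\text{ pairwise disjoint},\ x(F_k)\text{ repeats at every }f\in E\}$. Incremental sequence $\{W_{n(i)}f_i\}_{i=1}^I$: $n(1)\ge\dots\ge n(I)$ and $f_i\notin\bigcup_{j<i}W_{n(j)}f_j$. A sequence $\{W_n\}$ of finite sets with $1_G\in W_n$ is filling (with constant $C>0$) if for every incremental sequence $|\bigcup W_{n(i)}f_i|\ge C\sum|W_{n(i)}f_i|$. *)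

theory Defs
  imports "HOL-Probability.Probability"
begin

text \<open>Group G is a type 'g of class group_add (written additively, not necessarily
commutative); 0 is the identity, a + b the product ab, -a the inverse.\<close>

definition left_translate :: "'g::group_add \<Rightarrow> 'g set \<Rightarrow> 'g set" where
  "left_translate g A = (\<lambda>a. g + a) ` A"

definition right_translate :: "'g::group_add set \<Rightarrow> 'g \<Rightarrow> 'g set" where
  "right_translate A g = (\<lambda>a. a + g) ` A"

definition set_prod :: "'g::group_add set \<Rightarrow> 'g set \<Rightarrow> 'g set" where
  "set_prod A B = {a + b | a b. a \<in> A \<and> b \<in> B}"

definition set_inv :: "'g::group_add set \<Rightarrow> 'g set" where
  "set_inv A = uminus ` A"

definition folner :: "(nat \<Rightarrow> 'g::group_add set) \<Rightarrow> bool" where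
  "folner F \<longleftrightarrow> (\<forall>n. finite (F n) \<and> F n \<noteq> {}) \<and>
     (\<forall>g. (\<lambda>n. real (card ((F n - left_translate g (F n)) \<union> (left_translate g (F n) - F n))) / real (card (F n)))
            \<longlonglongrightarrow> 0)"

definition tempered_folner :: "(nat \<Rightarrow> 'g::group_add set) \<Rightarrow> bool" where
  "tempered_folner F \<longleftrightarrow> folner F \<and>
     (\<exists>C. \<forall>n. real (card (set_prod (\<Union>k<n. set_inv (F k)) (F n))) \<le> C * real (card (F n)))"

definition amenable_group :: "'g::group_add itself \<Rightarrow> bool" where
  "amenable_group _ \<longleftrightarrow> (\<exists>F :: nat \<Rightarrow> 'g set. folner F)"

definition measure_preserving_map :: "'w measure \<Rightarrow> ('w \<Rightarrow> 'w) \<Rightarrow> bool" where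
  "measure_preserving_map M f \<longleftrightarrow> f \<in> measurable M M \<and>
     (\<forall>A\<in>sets M. emeasure M (f -` A \<inter> space M) = emeasure M A)"

definition mp_action :: "'w measure \<Rightarrow> ('g::group_add \<Rightarrow> 'w \<Rightarrow> 'w) \<Rightarrow> bool" where
  "mp_action M T \<longleftrightarrow>
     (\<forall>\<omega>\<in>space M. T 0 \<omega> = \<omega>) \<and>
     (\<forall>g h. \<forall>\<omega>\<in>space M. T (g + h) \<omega> = T g (T h \<omega>)) \<and>
     (\<forall>g. measure_preserving_map M (T g))"

definition free_action :: "'w measure \<Rightarrow> ('g::group_add \<Rightarrow> 'w \<Rightarrow> 'w) \<Rightarrow> bool" where
  "free_action M T \<longleftrightarrow> (\<forall>\<omega>\<in>space M. \<forall>g. T g \<omega> = \<omega> \<longrightarrow> g = 0)"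

definition ergodic_action :: "'w measure \<Rightarrow> ('g::group_add \<Rightarrow> 'w \<Rightarrow> 'w) \<Rightarrow> bool" where
  "ergodic_action M T \<longleftrightarrow>
     (\<forall>A\<in>sets M. (\<forall>g. T g -` A \<inter> space M = A) \<longrightarrow> measure M A = 0 \<or> measure M A = 1)"

definition pattern :: "('g \<Rightarrow> 'w \<Rightarrow> 'w) \<Rightarrow> ('w \<Rightarrow> 's) \<Rightarrow> 'g set \<Rightarrow> 'w \<Rightarrow> ('g \<Rightarrow> 's option)" where
  "pattern T X E \<omega> = (\<lambda>g. if g \<in> E then Some (X (T g \<omega>)) else None)"

definition block_entropy :: "'w measure \<Rightarrow> ('g \<Rightarrow> 'w \<Rightarrow> 'w) \<Rightarrow> ('w \<Rightarrow> 's) \<Rightarrow> 'g set \<Rightarrow> real" where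
  "block_entropy M T X E =
     - (\<Sum>a \<in> pattern T X E ` space M.
          let p = measure M {\<omega> \<in> space M. pattern T X E \<omega> = a} in p * log 2 p)"

definition repeats_at :: "('g::group_add \<Rightarrow> 'w \<Rightarrow> 'w) \<Rightarrow> ('w \<Rightarrow> 's) \<Rightarrow> 'g set \<Rightarrow> 'w \<Rightarrow> 'g \<Rightarrow> bool" where
  "repeats_at T X E \<omega> f \<longleftrightarrow> (\<forall>e\<in>E. X (T e (T f \<omega>)) = X (T e \<omega>))"

definition U_stat :: "('g::group_add \<Rightarrow> 'w \<Rightarrow> 'w) \<Rightarrow> ('w \<Rightarrow> 's) \<Rightarrow> (nat \<Rightarrow> 'g set)
     \<Rightarrow> (nat \<Rightarrow> 'g set) \<Rightarrow> nat \<Rightarrow> nat \<Rightarrow> 'w \<Rightarrow> real" where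
  "U_stat T X F W k n \<omega> =
     real (Max {card E | E. 0 \<in> E \<and> E \<subseteq> W n \<and>
                 disjoint_family_on (\<lambda>f. right_translate (F k) f) E \<and>
                 (\<forall>f\<in>E. repeats_at T X (F k) \<omega> f)}) / real (card (W n))"

definition incremental :: "(nat \<Rightarrow> 'g::group_add set) \<Rightarrow> nat \<Rightarrow> (nat \<Rightarrow> nat) \<Rightarrow> (nat \<Rightarrow> 'g) \<Rightarrow> bool" where
  "incremental W I ns fs \<longleftrightarrow>
     (\<forall>i j. i \<le> j \<longrightarrow> j < I \<longrightarrow> ns j \<le> ns i) \<and>
     (\<forall>i<I. fs i \<notin> (\<Union>j<i. right_translate (W (ns j)) (fs j)))"

definition filling_with :: "(nat \<Rightarrow> 'g::group_add set) \<Rightarrow> real \<Rightarrow> bool" where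
  "filling_with W C \<longleftrightarrow> C > 0 \<and> (\<forall>n. finite (W n) \<and> 0 \<in> W n) \<and>
     (\<forall>I ns fs. incremental W I ns fs \<longrightarrow>
        real (card (\<Union>i<I. right_translate (W (ns i)) (fs i)))
          \<ge> C * (\<Sum>i<I. real (card (right_translate (W (ns i)) (fs i)))))"

definition filling :: "(nat \<Rightarrow> 'g::group_add set) \<Rightarrow> bool" where
  "filling W \<longleftrightarrow> (\<exists>C. filling_with W C)"

end

theory Submission
  imports Defs "HOL-Real_Asymp.Real_Asymp"
begin

text \<open>
  Fix \<open>\<delta> > 0\<close>. A recurrence statistic below \<open>\<theta> = 2 powr (- (h + \<delta>) * card (F k))\<close> at a point
  with \<open>F k\<close>-pattern \<open>a\<close> means that, within some window, the visits to the bad part of the cylinder of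
  \<open>a\<close> have density below \<open>\<theta> * (card (F k))\<^sup>2\<close>. A greedy incremental choice of windows and the filling
  condition turn this into the bound \<open>\<theta> * (card (F k))\<^sup>2 / C\<close> for the probability of that bad part,
  simply by averaging over a large Folner set; no ergodic theorem is used here. It therefore suffices
  to have, for almost every point, all of its late \<open>F k\<close>-patterns in sets of at most
  \<open>2 powr ((h + \<delta> / 3) * card (F k))\<close> patterns, and to apply the Borel-Cantelli lemma.

  Such sets come from a fixed shape \<open>E = F j\<close> whose entropy per site is close to \<open>h\<close>: take the patterns
  for which the information of the \<open>E\<close>-patterns around the sites of \<open>F k\<close> averages to about the entropy
  of \<open>E\<close>. Finner's inequality (the counting form of Shearer's) bounds their number without any tiling
  of the group, and the pointwise ergodic theorem along tempered Folner sequences shows that they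
  are typical. Its maximal inequality is proved with a deterministic fractional covering in place of
  random coverings, and its mean part by minimising the \<open>L2\<close>-norm.\<close>

section \<open>Translates, coverings and Folner sets\<close>

lemma right_translate_iff: "x \<in> right_translate A g \<longleftrightarrow> x - g \<in> A"
  for x g :: "'g::group_add"
  unfolding right_translate_def by (force simp: image_iff algebra_simps)

lemma left_translate_iff: "x \<in> left_translate g A \<longleftrightarrow> - g + x \<in> A"
  for x g :: "'g::group_add"
  unfolding left_translate_def
  by (auto simp: image_iff add.assoc[symmetric] intro!: bexI[of _ "- g + x"])

lemma set_prodI: "a \<in> A \<Longrightarrow> b \<in> B \<Longrightarrow> a + b \<in> set_prod A B"
  unfolding set_prod_def by blast

lemma set_prod_altdef: "set_prod A B = (\<lambda>(a, b). a + b) ` (A \<times> B)"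
  unfolding set_prod_def by auto

lemma finite_set_prod: "finite A \<Longrightarrow> finite B \<Longrightarrow> finite (set_prod A B)"
  unfolding set_prod_altdef by auto

lemma card_set_prod_le: "finite A \<Longrightarrow> finite B \<Longrightarrow> card (set_prod A B) \<le> card A * card B"
  unfolding set_prod_altdef using card_image_le[of "A \<times> B"] by (simp add: card_cartesian_product)

lemma card_right_translate: "card (right_translate A g) = card A"
  for g :: "'g::group_add"
  unfolding right_translate_def by (intro card_image inj_onI) simp

lemma finite_right_translate: "finite A \<Longrightarrow> finite (right_translate A g)"
  unfolding right_translate_def by simp

lemma finite_left_translate: "finite A \<Longrightarrow> finite (left_translate g A)"
  unfolding left_translate_def by simp

lemma finite_set_inv: "finite A \<Longrightarrow> finite (set_inv A)"
  unfolding set_inv_def by simp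

lemma card_set_inv_le: "finite A \<Longrightarrow> card (set_inv A) \<le> card A"
  unfolding set_inv_def by (rule card_image_le)

definition folner_defect :: "(nat \<Rightarrow> 'g::group_add set) \<Rightarrow> 'g \<Rightarrow> nat \<Rightarrow> real" where
  "folner_defect F g n =
     real (card ((F n - left_translate g (F n)) \<union> (left_translate g (F n) - F n))) / real (card (F n))"

lemma folnerD:
  assumes "folner F"
  shows "finite (F n)" "F n \<noteq> {}" "card (F n) > 0" "folner_defect F g \<longlonglongrightarrow> 0"
  using assms unfolding folner_def folner_defect_def by (auto simp: card_gt_0_iff)

text \<open>A point of \<open>K F n\<close> outside \<open>F n\<close> lies in
  \<open>g F n - F n\<close> for some \<open>g\<close> in \<open>K\<close>, so a finite sum of
  Folner defects dominates the ratio. It makes boundary terms negligible wherever a finite shape is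
  moved along \<open>F n\<close>.\<close>

lemma folner_set_prod_diff:
  assumes F: "folner F" and K: "finite K"
  shows "(\<lambda>n. real (card (set_prod K (F n) - F n)) / real (card (F n))) \<longlonglongrightarrow> 0"
proof (rule tendsto_sandwich[OF _ _ tendsto_const])
  show "(\<lambda>n. \<Sum>g\<in>K. folner_defect F g n) \<longlonglongrightarrow> 0"
    using tendsto_sum[of K "\<lambda>g. folner_defect F g" "\<lambda>_. 0"] folnerD(4)[OF F] by simp
  have "real (card (set_prod K (F n) - F n)) / real (card (F n)) \<le> (\<Sum>g\<in>K. folner_defect F g n)" for n
  proof -
    let ?D = "\<lambda>g. left_translate g (F n) - F n"
    have "set_prod K (F n) - F n \<subseteq> (\<Union>g\<in>K. ?D g)"
    proof (rule subsetI)
      fix x assume x: "x \<in> set_prod K (F n) - F n"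
      then obtain g a where "g \<in> K" "a \<in> F n" "x = g + a" unfolding set_prod_def by blast
      then have "x \<in> ?D g" using x by (simp add: left_translate_iff)
      with \<open>g \<in> K\<close> show "x \<in> (\<Union>g\<in>K. ?D g)" by (rule UN_I)
    qed
    then have "card (set_prod K (F n) - F n) \<le> card (\<Union>g\<in>K. ?D g)"
      using K folnerD(1)[OF F] finite_left_translate by (intro card_mono) auto
    also have "\<dots> \<le> (\<Sum>g\<in>K. card (?D g))" by (rule card_UN_le[OF K])
    finally have "real (card (set_prod K (F n) - F n)) \<le> (\<Sum>g\<in>K. real (card (?D g)))"
      by (metis of_nat_le_iff of_nat_sum)
    then have "real (card (set_prod K (F n) - F n)) / real (card (F n))
        \<le> (\<Sum>g\<in>K. real (card (?D g)) / real (card (F n)))"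
      unfolding sum_divide_distrib[symmetric] by (rule divide_right_mono) simp
    also have "\<dots> \<le> (\<Sum>g\<in>K. folner_defect F g n)"
      unfolding folner_defect_def using folnerD(1)[OF F]
      by (intro sum_mono divide_right_mono of_nat_mono card_mono) (auto intro: finite_left_translate)
    finally show ?thesis .
  qed
  then show "\<forall>\<^sub>F n in sequentially. real (card (set_prod K (F n) - F n)) / real (card (F n))
      \<le> (\<Sum>g\<in>K. folner_defect F g n)" by simp
qed simp

lemma card_le_diff: "finite A \<Longrightarrow> finite B \<Longrightarrow> card A \<le> card B + card (A - B)"
  by (metis card_mono card_Un_le finite_Diff finite_UnI Un_Diff_cancel Un_upper2 le_trans sup_commute)

text \<open>A greedy fractional covering: points are treated in order of decreasing scale \<open>j\<close>, and
  \<open>a\<close> is accepted iff the tiles \<open>F (j b) + b\<close> of strictly larger scale, each of density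
  \<open>1 / card (F (j b))\<close>, put at most total weight 1 on every point of \<open>F (j a) + a\<close>.\<close>

lemma fractional_covering:
  fixes F :: "nat \<Rightarrow> 'g::group_add set" and j :: "'g \<Rightarrow> nat"
  assumes fin: "\<And>n. finite (F n)" and ne: "\<And>n. F n \<noteq> {}" and S: "finite S"
    and tempered: "\<And>n. real (card (set_prod (\<Union>k<n. set_inv (F k)) (F n))) \<le> C * real (card (F n))"
  shows "\<exists>Acc\<subseteq>S. real (card S) \<le> (1 + C) * real (card Acc) \<and>
           (\<forall>x. (\<Sum>b | b \<in> Acc \<and> x \<in> right_translate (F (j b)) b. 1 / real (card (F (j b)))) \<le> 2)"
proof -
  define load where "load A n x =
      (\<Sum>b | b \<in> A \<and> n < j b \<and> x \<in> right_translate (F (j b)) b. 1 / real (card (F (j b))))"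
    for A n x
  define ok where "ok A a \<longleftrightarrow> (\<forall>x\<in>right_translate (F (j a)) a. load A (j a) x \<le> 1)" for A a
  have pos: "card (F n) > 0" for n using fin ne by (simp add: card_gt_0_iff)
  \<comment> \<open>Whether a point is accepted depends only on accepted points of strictly larger
    scale. Inserting points by decreasing \<open>j\<close> therefore changes no earlier verdict, and
    the self-referential condition has a solution.\<close>
  have "\<exists>Acc\<subseteq>S. \<forall>a\<in>S. a \<in> Acc \<longleftrightarrow> ok Acc a"
    using S
  proof (induction rule: finite_ranking_induct[where f = "\<lambda>a. - int (j a)"])
    case empty
    then show ?case by simp
  next
    case (insert x S)
    then obtain A where A: "A \<subseteq> S" "\<forall>a\<in>S. a \<in> A \<longleftrightarrow> ok A a" by blast
    show ?case
    proof (cases "x \<in> S")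
      case True
      then show ?thesis using A by (intro exI[of _ A]) auto
    next
      case False
      have le: "j x \<le> j y" if "y \<in> S" for y using insert.hyps(2)[OF that] by simp
      have "load (Set.insert x A) (j y) z = load A (j y) z" if "y \<in> Set.insert x S" for y z
      proof -
        have "\<not> j y < j x" using le that by (auto simp: not_less)
        then show ?thesis unfolding load_def by (intro sum.cong) auto
      qed
      then have ok: "ok (Set.insert x A) y = ok A y" if "y \<in> Set.insert x S" for y
        unfolding ok_def using that by simp
      show ?thesis
      proof (cases "ok A x")
        case True
        then show ?thesis using A ok False by (intro exI[of _ "Set.insert x A"]) auto
      next
        case nok: False
        then show ?thesis using A False by (intro exI[of _ A]) auto
      qed
    qed
  qed
  then obtain Acc where Acc: "Acc \<subseteq> S" "\<And>a. a \<in> S \<Longrightarrow> a \<in> Acc \<longleftrightarrow> ok Acc a" by blast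
  have finAcc: "finite Acc" using Acc(1) S finite_subset by blast
  have "(\<Sum>b | b \<in> Acc \<and> x \<in> right_translate (F (j b)) b. 1 / real (card (F (j b)))) \<le> 2" for x
  proof -
    let ?B = "{b \<in> Acc. x \<in> right_translate (F (j b)) b}"
    show ?thesis
    proof (cases "?B = {}")
      case True
      then show ?thesis by (metis (no_types, lifting) sum.empty zero_le_numeral)
    next
      case False
      \<comment> \<open>The smallest scale among accepted tiles through \<open>x\<close>. Tiles of
        larger scale weigh at most 1 there because a tile of scale \<open>n\<close> was accepted. At
        scale \<open>n\<close> itself at most \<open>card (F n)\<close> tiles contain
        \<open>x\<close>, each of weight \<open>1 / card (F n)\<close>. Hence the bound 2.\<close>
      define n where "n = Min (j ` ?B)"
      have "n \<in> j ` ?B" unfolding n_def using False finAcc by (intro Min_in) auto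
      then obtain a where a: "a \<in> ?B" "j a = n" by blast
      have n_le: "n \<le> j b" if "b \<in> ?B" for b
        unfolding n_def using that finAcc by (intro Min_le) auto
      have "ok Acc a" using a Acc by blast
      then have load: "load Acc n x \<le> 1" using a unfolding ok_def by auto
      let ?E = "{b \<in> ?B. j b = n}"
      have "(\<lambda>b. x - b) ` ?E \<subseteq> F n" by (auto simp: right_translate_iff)
      then have "card ((\<lambda>b. x - b) ` ?E) \<le> card (F n)" by (intro card_mono fin)
      moreover have "card ((\<lambda>b. x - b) ` ?E) = card ?E" 
        by (intro card_image inj_onI) (metis diff_eq_diff_eq add_left_cancel diff_add_cancel)
      ultimately have "(\<Sum>b\<in>?E. 1 / real (card (F (j b)))) \<le> 1" 
        using pos[of n] by (simp add: field_simps)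
      moreover have "(\<Sum>b\<in>?B. 1 / real (card (F (j b)))) =
          (\<Sum>b\<in>{b \<in> ?B. n < j b} \<union> ?E. 1 / real (card (F (j b))))"
        using n_le by (intro sum.cong) (auto simp: le_less)
      moreover have "\<dots> = (\<Sum>b\<in>{b \<in> ?B. n < j b}. 1 / real (card (F (j b)))) +
          (\<Sum>b\<in>?E. 1 / real (card (F (j b))))"
        using finAcc by (intro sum.union_disjoint) auto
      moreover have "(\<Sum>b\<in>{b \<in> ?B. n < j b}. 1 / real (card (F (j b)))) = load Acc n x"
        unfolding load_def by (intro sum.cong) auto
      ultimately show ?thesis using load by linarith
    qed
  qed
  moreover have "real (card S) \<le> (1 + C) * real (card Acc)"
  proof -
    define K where "K n = set_prod (\<Union>k<n. set_inv (F k)) (F n)" for n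
    have finK: "finite (K n)" for n
      unfolding K_def by (intro finite_set_prod finite_UN_I finite_set_inv fin) auto
    define R where "R = S - Acc"
    have finR: "finite R" unfolding R_def using S by simp
    \<comment> \<open>A charging scheme: a rejected \<open>a\<close> charges the accepted
      \<open>b\<close> in whose enlarged tile \<open>K (j b) + b\<close> it lies. Each rejected
      point gives out at least 1, and by temperedness each accepted point receives at most
      \<open>C\<close>.\<close>
    let ?t = "\<lambda>a b. if a \<in> right_translate (K (j b)) b then 1 / real (card (F (j b))) else 0"
    have ge: "1 \<le> (\<Sum>b\<in>Acc. ?t a b)" if "a \<in> R" for a
    proof -
      from that Acc(2) have "\<not> ok Acc a" unfolding R_def by blast
      then obtain x where x: "x \<in> right_translate (F (j a)) a" "load Acc (j a) x > 1"
        unfolding ok_def by force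
      have "load Acc (j a) x \<le> (\<Sum>b | b \<in> Acc \<and> a \<in> right_translate (K (j b)) b. 1 / real (card (F (j b))))"
        unfolding load_def
      proof (intro sum_mono2)
        show "{b \<in> Acc. j a < j b \<and> x \<in> right_translate (F (j b)) b}
          \<subseteq> {b \<in> Acc. a \<in> right_translate (K (j b)) b}"
        proof safe
          fix b assume b: "j a < j b" "x \<in> right_translate (F (j b)) b"
          \<comment> \<open>Both tiles contain \<open>x\<close>, so \<open>a - b\<close> lies in
            \<open>F (j a)\<close> inverted times \<open>F (j b)\<close>. The strict inequality of
            scales places this inside the temperedness set, whose union runs over
            \<open>k < j b\<close>.\<close>
          have "a - b = - (x - a) + (x - b)" by (simp add: algebra_simps)
          also have "\<dots> \<in> K (j b)"
            unfolding K_def using b x(1)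
            by (intro set_prodI) (auto simp: right_translate_iff set_inv_def simp del: minus_diff_eq)
          finally show "a \<in> right_translate (K (j b)) b" by (simp add: right_translate_iff)
        qed
      qed (use finAcc in auto)
      also have "\<dots> = (\<Sum>b\<in>Acc. ?t a b)"
        using finAcc by (simp add: sum.inter_filter)
      finally show ?thesis using x(2) by simp
    qed
    have "real (card R) \<le> (\<Sum>a\<in>R. \<Sum>b\<in>Acc. ?t a b)"
      using sum_mono[of R "\<lambda>_. 1" "\<lambda>a. \<Sum>b\<in>Acc. ?t a b"] ge by simp
    also have "\<dots> = (\<Sum>b\<in>Acc. \<Sum>a\<in>R. ?t a b)" by (rule sum.swap)
    also have "\<dots> \<le> (\<Sum>b\<in>Acc. C)"
    proof (rule sum_mono)
      fix b
      let ?n = "j b"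
      have "(\<Sum>a\<in>R. ?t a b) = real (card {a \<in> R. a \<in> right_translate (K ?n) b}) / real (card (F ?n))"
        using finR by (simp add: sum.inter_filter[symmetric])
      also have "\<dots> \<le> real (card (right_translate (K ?n) b)) / real (card (F ?n))"
        by (intro divide_right_mono of_nat_mono card_mono finite_right_translate finK) auto
      also have "\<dots> \<le> C"
        using tempered[of ?n] pos[of ?n] by (simp add: card_right_translate K_def field_simps)
      finally show "(\<Sum>a\<in>R. ?t a b) \<le> C" .
    qed
    finally have "real (card R) \<le> C * real (card Acc)" by (simp add: mult.commute)
    moreover have "card S = card R + card Acc"
      unfolding R_def using Acc(1) S
      by (metis add.commute card_Diff_subset card_mono finite_subset le_add_diff_inverse)
    ultimately show ?thesis by (simp add: algebra_simps)
  qed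
  ultimately show ?thesis using Acc(1) by blast
qed

section \<open>Incremental covers and the filling condition\<close>

text \<open>Centres are scanned by decreasing window index, and a centre that is already covered is
  skipped; this skipping is exactly the incremental condition. A chosen window covers its own centre
  because it contains 0.\<close>

lemma incremental_cover:
  fixes W :: "nat \<Rightarrow> 'g::group_add set" and n :: "'g \<Rightarrow> nat"
  assumes W0: "\<And>n. 0 \<in> W n" and S: "finite S"
  shows "\<exists>I fs. incremental W I (\<lambda>i. n (fs i)) fs \<and> (\<forall>i<I. fs i \<in> S) \<and>
           S \<subseteq> (\<Union>i<I. right_translate (W (n (fs i))) (fs i))"
  using S
proof (induction rule: finite_ranking_induct[where f = "\<lambda>a. - int (n a)"])
  case empty
  then show ?case by (intro exI[of _ 0]) (auto simp: incremental_def)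
next
  case (insert x S)
  then obtain I fs where inc: "incremental W I (\<lambda>i. n (fs i)) fs" and fs: "\<forall>i<I. fs i \<in> S"
    and sub: "S \<subseteq> (\<Union>i<I. right_translate (W (n (fs i))) (fs i))" by blast
  have le: "n x \<le> n y" if "y \<in> S" for y using insert.hyps(2)[OF that] by simp
  show ?case
  proof (cases "x \<in> (\<Union>i<I. right_translate (W (n (fs i))) (fs i))")
    case True
    then show ?thesis using inc fs sub by (intro exI[of _ I] exI[of _ fs]) auto
  next
    case False
    let ?fs = "fs(I := x)"
    have "incremental W (Suc I) (\<lambda>i. n (?fs i)) ?fs"
      unfolding incremental_def
    proof (intro conjI allI impI)
      fix i j assume "i \<le> j" "j < Suc I"
      then show "n (?fs j) \<le> n (?fs i)"
        using inc fs le unfolding incremental_def by (auto simp: less_Suc_eq)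
    next
      fix i assume "i < Suc I"
      then show "?fs i \<notin> (\<Union>j<i. right_translate (W (n (?fs j))) (?fs j))"
        using inc False unfolding incremental_def by (auto simp: less_Suc_eq)
    qed
    moreover have "x \<in> right_translate (W (n x)) x" using W0 by (simp add: right_translate_iff)
    moreover have "insert x S \<subseteq> (\<Union>i<Suc I. right_translate (W (n (?fs i))) (?fs i))"
      using sub calculation(2) by (force simp: lessThan_Suc)
    moreover have "\<forall>i<Suc I. ?fs i \<in> insert x S" using fs by (auto simp: less_Suc_eq)
    ultimately show ?thesis by blast
  qed
qed

text \<open>For an incremental cover, filling bounds the sum of the window sizes by
  \<open>1 / C\<close> times the size of their union. A density bound inside each chosen window thus
  becomes one relative to \<open>D\<close>, at the cost of the factor \<open>1 / C\<close>.\<close>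

lemma filling_card_le:
  fixes W :: "nat \<Rightarrow> 'g::group_add set" and n :: "'g \<Rightarrow> nat"
  assumes W: "filling_with W C" and S: "finite S" and \<beta>: "\<beta> \<ge> 0"
    and D: "finite D" "\<And>g. g \<in> S \<Longrightarrow> right_translate (W (n g)) g \<subseteq> D"
    and sparse: "\<And>g. g \<in> S \<Longrightarrow>
      real (card (S \<inter> right_translate (W (n g)) g)) \<le> \<beta> * real (card (W (n g)))"
  shows "real (card S) \<le> \<beta> / C * real (card D)"
proof -
  have C: "C > 0" and W0: "\<And>n. 0 \<in> W n" and finW: "\<And>n. finite (W n)"
    using W unfolding filling_with_def by auto
  obtain I fs where inc: "incremental W I (\<lambda>i. n (fs i)) fs" and fs: "\<forall>i<I. fs i \<in> S"
    and sub: "S \<subseteq> (\<Union>i<I. right_translate (W (n (fs i))) (fs i))"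
    using incremental_cover[of W, OF W0 S] by blast
  let ?T = "\<lambda>i. right_translate (W (n (fs i))) (fs i)"
  have "S = (\<Union>i<I. S \<inter> ?T i)" using sub by auto
  then have "card S \<le> (\<Sum>i<I. card (S \<inter> ?T i))" using card_UN_le[of "{..<I}" "\<lambda>i. S \<inter> ?T i"] by simp
  then have "real (card S) \<le> (\<Sum>i<I. real (card (S \<inter> ?T i)))" by (metis of_nat_le_iff of_nat_sum)
  also have "\<dots> \<le> (\<Sum>i<I. \<beta> * real (card (?T i)))"
    using sparse fs by (intro sum_mono) (auto simp: card_right_translate)
  also have "\<dots> = \<beta> / C * (C * (\<Sum>i<I. real (card (?T i))))" using C by (simp add: sum_distrib_left)
  also have "\<dots> \<le> \<beta> / C * real (card (\<Union>i<I. ?T i))"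
    using W inc C \<beta> unfolding filling_with_def by (intro mult_left_mono) auto
  also have "\<dots> \<le> \<beta> / C * real (card D)"
    using D fs C \<beta> by (intro mult_left_mono of_nat_mono card_mono) auto
  finally show ?thesis .
qed

text \<open>Take a maximal disjoint subfamily \<open>A\<close> that keeps 0. By maximality each
  translate \<open>F e\<close> meets some \<open>F a\<close> with \<open>a\<close> in
  \<open>A\<close>, so \<open>e\<close> lies in \<open>F\<close> inverted times \<open>F a\<close>,
  which leaves at most \<open>(card F)\<^sup>2\<close> candidates for each \<open>a\<close>.\<close>

lemma disjoint_translates_subset:
  fixes F :: "'g::group_add set"
  assumes F: "finite F" "F \<noteq> {}" and E: "finite E" "0 \<in> E"
  obtains E' where "E' \<subseteq> E" "0 \<in> E'" "disjoint_family_on (right_translate F) E'"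
    "card E \<le> (card F)\<^sup>2 * card E'"
proof -
  define P where "P A \<longleftrightarrow> A \<subseteq> E \<and> 0 \<in> A \<and> disjoint_family_on (right_translate F) A" for A
  have "P {0}" unfolding P_def using E by (auto simp: disjoint_family_on_def)
  moreover have "finite {A. P A}"
    by (rule finite_subset[of _ "Pow E"]) (auto simp: P_def E)
  ultimately obtain A where A: "P A" and max: "\<And>B. P B \<Longrightarrow> A \<subseteq> B \<Longrightarrow> A = B"
    using finite_has_maximal[of "{A. P A}"] by auto
  have finA: "finite A" using A E finite_subset unfolding P_def by blast
  let ?Q = "set_prod (set_inv F) F"
  have "E \<subseteq> set_prod ?Q A"
  proof
    fix e assume e: "e \<in> E"
    have "\<exists>a\<in>A. right_translate F e \<inter> right_translate F a \<noteq> {}"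
    proof (rule ccontr)
      assume none: "\<not> ?thesis"
      have "P (insert e A)" 
        using A e none unfolding P_def disjoint_family_on_def by (auto simp: Int_commute) 
      then have "e \<in> A" using max by blast
      then show False using none F by (auto simp: right_translate_def)
    qed
    then obtain a y where a: "a \<in> A" "y - e \<in> F" "y - a \<in> F"
      by (auto simp: right_translate_iff)
    have "e = (- (y - e) + (y - a)) + a" by (simp add: algebra_simps)
    also have "\<dots> \<in> set_prod ?Q A" using a by (intro set_prodI) (auto simp: set_inv_def simp del: minus_diff_eq)
    finally show "e \<in> set_prod ?Q A" .
  qed
  then have "card E \<le> card (set_prod ?Q A)"
    using finA F by (intro card_mono finite_set_prod finite_set_inv)
  also have "\<dots> \<le> card ?Q * card A"
    using finA F by (intro card_set_prod_le finite_set_prod finite_set_inv)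
  also have "\<dots> \<le> (card F * card F) * card A"
    using card_set_prod_le[of "set_inv F" F] card_set_inv_le[of F] finite_set_inv[of F] F
    by (intro mult_right_mono) (auto intro: order_trans mult_right_mono)
  finally show thesis using that[of A] A by (simp add: P_def power2_eq_square)
qed

section \<open>The pointwise ergodic theorem\<close>

locale pmp_action = prob_space M for M :: "'w measure" +
  fixes T :: "'g::{group_add, countable} \<Rightarrow> 'w \<Rightarrow> 'w"
  assumes action: "mp_action M T"
begin

lemma T_measurable [measurable]: "T g \<in> measurable M M"
  using action unfolding mp_action_def measure_preserving_map_def by blast

lemma T_space: "\<omega> \<in> space M \<Longrightarrow> T g \<omega> \<in> space M"
  using measurable_space[OF T_measurable] .

lemma T_zero: "\<omega> \<in> space M \<Longrightarrow> T 0 \<omega> = \<omega>"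
  and T_add: "\<omega> \<in> space M \<Longrightarrow> T (g + h) \<omega> = T g (T h \<omega>)"
  using action unfolding mp_action_def by blast+

lemma distr_T: "distr M M (T g) = M"
  using action unfolding mp_action_def measure_preserving_map_def
  by (intro measure_eqI) (auto simp: emeasure_distr)

lemma integral_T:
  fixes f :: "'w \<Rightarrow> real"
  shows "f \<in> borel_measurable M \<Longrightarrow> (\<integral>\<omega>. f (T g \<omega>) \<partial>M) = (\<integral>\<omega>. f \<omega> \<partial>M)"
  using integral_distr[OF T_measurable[of g], of f] by (simp add: distr_T)

lemma integrable_T:
  fixes f :: "'w \<Rightarrow> real"
  shows "integrable M f \<Longrightarrow> integrable M (\<lambda>\<omega>. f (T g \<omega>))"
  by (rule integrable_distr[OF T_measurable]) (simp add: distr_T)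

lemma AE_T: "(AE \<omega> in M. P \<omega>) \<Longrightarrow> AE \<omega> in M. P (T g \<omega>)"
  by (rule AE_distrD[OF T_measurable]) (subst distr_T)

lemma prob_T:
  assumes "{\<omega> \<in> space M. P \<omega>} \<in> events"
  shows "prob {\<omega> \<in> space M. P (T g \<omega>)} = prob {\<omega> \<in> space M. P \<omega>}"
proof -
  have "T g -` {\<omega> \<in> space M. P \<omega>} \<inter> space M = {\<omega> \<in> space M. P (T g \<omega>)}"
    using T_space by auto
  then show ?thesis
    using measure_distr[OF T_measurable assms, of g] by (simp add: distr_T)
qed

section \<open>Transference and the maximal inequality\<close>

text \<open>Integrate the counting inequality with \<open>A = F n\<close>. Invariance turns the left
  side into \<open>card (F n)\<close> times the probability and the right side into
  \<open>card (K F n)\<close> times the integral of \<open>e\<close>; the quotient of the two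
  cardinalities is asymptotically at most 1.\<close>

lemma transference:
  fixes F :: "nat \<Rightarrow> 'g set" and e :: "'w \<Rightarrow> real"
  assumes F: "folner F" and K: "finite K"
    and e: "integrable M e" "\<And>\<omega>. \<omega> \<in> space M \<Longrightarrow> e \<omega> \<ge> 0"
    and [measurable]: "Measurable.pred M P"
    and local: "\<And>\<omega> A. \<omega> \<in> space M \<Longrightarrow> finite A \<Longrightarrow>
      real (card {g \<in> A. P (T g \<omega>)}) \<le> (\<Sum>g\<in>set_prod K A. e (T g \<omega>))"
  shows "prob {\<omega> \<in> space M. P \<omega>} \<le> (\<integral>\<omega>. e \<omega> \<partial>M)"
proof (rule LIMSEQ_le_const)
  let ?I = "\<integral>\<omega>. e \<omega> \<partial>M"
  let ?d = "\<lambda>n. real (card (set_prod K (F n) - F n)) / real (card (F n))"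
  show "(\<lambda>n. (1 + ?d n) * ?I) \<longlonglongrightarrow> ?I"
    by (rule tendsto_eq_intros folner_set_prod_diff[OF F K] refl)+ simp
  have I: "?I \<ge> 0" using e(2) by (intro integral_nonneg_AE) auto
  have "prob {\<omega> \<in> space M. P \<omega>} \<le> (1 + ?d n) * ?I" for n
  proof -
    note fin = folnerD(1)[OF F, of n] and pos = folnerD(3)[OF F, of n]
    have fin': "finite (set_prod K (F n))" using K fin by (rule finite_set_prod)
    have "real (card (F n)) * prob {\<omega> \<in> space M. P \<omega>} = (\<Sum>g\<in>F n. prob {\<omega> \<in> space M. P (T g \<omega>)})"
      by (subst prob_T) auto
    also have "\<dots> = (\<Sum>g\<in>F n. \<integral>\<omega>. indicator {\<omega> \<in> space M. P (T g \<omega>)} \<omega> \<partial>M)"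
      by (intro sum.cong) auto
    also have "\<dots> = (\<integral>\<omega>. (\<Sum>g\<in>F n. indicator {\<omega> \<in> space M. P (T g \<omega>)} \<omega>) \<partial>M)"
      by (intro Bochner_Integration.integral_sum[symmetric] integrable_real_indicator)
        (auto simp: emeasure_eq_measure)
    also have "\<dots> = (\<integral>\<omega>. real (card {g \<in> F n. P (T g \<omega>)}) \<partial>M)"
      using fin by (intro Bochner_Integration.integral_cong)
        (auto simp: indicator_def sum.inter_filter[symmetric] Int_def)
    also have "\<dots> \<le> (\<integral>\<omega>. (\<Sum>g\<in>set_prod K (F n). e (T g \<omega>)) \<partial>M)"
      using local[OF _ fin] e(2) T_space
      by (intro integral_mono_AE' Bochner_Integration.integrable_sum integrable_T e AE_I2 sum_nonneg) auto
    also have "\<dots> = (\<Sum>g\<in>set_prod K (F n). \<integral>\<omega>. e (T g \<omega>) \<partial>M)"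
      by (intro Bochner_Integration.integral_sum integrable_T e)
    also have "\<dots> = real (card (set_prod K (F n))) * ?I"
      using e(1) by (simp add: integral_T)
    also have "\<dots> \<le> (real (card (F n)) + real (card (set_prod K (F n) - F n))) * ?I"
      using card_le_diff[OF fin' fin] I by (intro mult_right_mono) auto
    also have "\<dots> = real (card (F n)) * ((1 + ?d n) * ?I)" using pos by (simp add: field_simps)
    finally show ?thesis using pos by simp
  qed
  then show "\<exists>N. \<forall>n\<ge>N. prob {\<omega> \<in> space M. P \<omega>} \<le> (1 + ?d n) * ?I" by blast
qed

definition avg :: "(nat \<Rightarrow> 'g set) \<Rightarrow> nat \<Rightarrow> ('w \<Rightarrow> real) \<Rightarrow> 'w \<Rightarrow> real" where
  "avg F n f \<omega> = (\<Sum>g\<in>F n. f (T g \<omega>)) / real (card (F n))"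

lemma avg_measurable [measurable]:
  assumes [measurable]: "f \<in> borel_measurable M"
  shows "avg F n f \<in> borel_measurable M"
  unfolding avg_def by measurable

text \<open>Along a finite piece of an orbit every bad point has a tile on which \<open>e\<close>
  averages above \<open>c\<close>. The fractional covering keeps a fixed share of these points with
  bounded overlap, and transference carries the count back to the space. The cut-off
  \<open>N\<close> confines the tiles to a finite set.\<close>

lemma maximal_inequality_finite:
  assumes F: "folner F" and C: "C \<ge> 0"
    and tempered: "\<And>n. real (card (set_prod (\<Union>k<n. set_inv (F k)) (F n))) \<le> C * real (card (F n))"
    and e: "integrable M e" "\<And>\<omega>. \<omega> \<in> space M \<Longrightarrow> e \<omega> \<ge> 0" and c: "c > 0"
  shows "prob {\<omega> \<in> space M. \<exists>k\<le>N. avg F k e \<omega> > c} \<le> 2 * (1 + C) / c * (\<integral>\<omega>. e \<omega> \<partial>M)"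
proof -
  have [measurable]: "e \<in> borel_measurable M" using e by simp
  let ?P = "\<lambda>\<omega>. \<exists>k\<le>N. avg F k e \<omega> > c"
  have "prob {\<omega> \<in> space M. ?P \<omega>} \<le> (\<integral>\<omega>. 2 * (1 + C) / c * e \<omega> \<partial>M)"
  proof (rule transference[OF F, of "\<Union>k\<le>N. F k"])
    fix \<omega> and A :: "'g set" assume \<omega>: "\<omega> \<in> space M" and A: "finite A"
    define S where "S = {g \<in> A. ?P (T g \<omega>)}"
    have "\<forall>g\<in>S. \<exists>k. k \<le> N \<and> avg F k e (T g \<omega>) > c" unfolding S_def by blast
    then obtain j where j: "\<And>g. g \<in> S \<Longrightarrow> j g \<le> N" "\<And>g. g \<in> S \<Longrightarrow> avg F (j g) e (T g \<omega>) > c"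
      using bchoice[of S "\<lambda>g k. k \<le> N \<and> avg F k e (T g \<omega>) > c"] by blast
    have "finite S" using A unfolding S_def by simp
    from fractional_covering[OF folnerD(1,2)[OF F] this tempered, of j]
    obtain Acc where Acc: "Acc \<subseteq> S" "real (card S) \<le> (1 + C) * real (card Acc)"
      and load: "\<And>x. (\<Sum>b | b \<in> Acc \<and> x \<in> right_translate (F (j b)) b. 1 / real (card (F (j b)))) \<le> 2"
      by blast
    let ?D = "set_prod (\<Union>k\<le>N. F k) A"
    have finD: "finite ?D" using A folnerD(1)[OF F] by (intro finite_set_prod) auto
    have finAcc: "finite Acc" using Acc(1) \<open>finite S\<close> finite_subset by blast
    have e': "e (T g \<omega>) \<ge> 0" for g using e(2) T_space \<omega> by blast
    have sub: "right_translate (F (j b)) b \<subseteq> ?D" if "b \<in> Acc" for b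
      using j(1)[of b] Acc(1) that unfolding right_translate_def S_def
      by (auto intro!: set_prodI UN_I[of "j b"])
    have "c * real (card Acc) = (\<Sum>b\<in>Acc. c)" by simp
    also have "\<dots> \<le> (\<Sum>b\<in>Acc. avg F (j b) e (T b \<omega>))"
      using j(2) Acc(1) by (intro sum_mono less_imp_le) auto
    also have "\<dots> = (\<Sum>b\<in>Acc. \<Sum>x\<in>right_translate (F (j b)) b. e (T x \<omega>) / real (card (F (j b))))"
    proof (rule sum.cong[OF refl])
      fix b
      have "(\<Sum>g\<in>F (j b). e (T g (T b \<omega>))) = (\<Sum>x\<in>right_translate (F (j b)) b. e (T x \<omega>))"
        unfolding right_translate_def by (subst sum.reindex) (auto simp: inj_on_def T_add \<omega>)
      then show "avg F (j b) e (T b \<omega>) =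
          (\<Sum>x\<in>right_translate (F (j b)) b. e (T x \<omega>) / real (card (F (j b))))"
        unfolding avg_def by (simp add: sum_divide_distrib)
    qed
    also have "\<dots> = (\<Sum>b\<in>Acc. \<Sum>x | x \<in> ?D \<and> x \<in> right_translate (F (j b)) b. e (T x \<omega>) / real (card (F (j b))))"
      using sub by (intro sum.cong) auto
    \<comment> \<open>After exchanging the sums, each value \<open>e (T x \<omega>)\<close> is
      multiplied by the total density of the accepted tiles through \<open>x\<close>, which the
      covering bounds by 2.\<close>
    also have "\<dots> = (\<Sum>x\<in>?D. \<Sum>b | b \<in> Acc \<and> x \<in> right_translate (F (j b)) b. e (T x \<omega>) / real (card (F (j b))))"
      by (rule sum.swap_restrict[OF finAcc finD])
    also have "\<dots> = (\<Sum>x\<in>?D. e (T x \<omega>) *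
        (\<Sum>b | b \<in> Acc \<and> x \<in> right_translate (F (j b)) b. 1 / real (card (F (j b)))))"
      by (simp add: sum_distrib_left)
    also have "\<dots> \<le> (\<Sum>x\<in>?D. e (T x \<omega>) * 2)"
      by (intro sum_mono mult_left_mono load e')
    also have "\<dots> = 2 * (\<Sum>x\<in>?D. e (T x \<omega>))" by (simp add: sum_distrib_left mult.commute)
    finally have "real (card Acc) \<le> 2 / c * (\<Sum>x\<in>?D. e (T x \<omega>))"
      using c by (simp add: field_simps)
    then have "real (card S) \<le> (1 + C) * (2 / c * (\<Sum>x\<in>?D. e (T x \<omega>)))"
      using Acc(2) C by (meson add_nonneg_nonneg mult_left_mono order_trans zero_le_one)
    then show "real (card {g \<in> A. ?P (T g \<omega>)}) \<le> (\<Sum>g\<in>?D. 2 * (1 + C) / c * e (T g \<omega>))"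
      unfolding S_def by (subst sum_distrib_left[symmetric]) (simp add: algebra_simps)
  qed (use e C c folnerD(1)[OF F] in \<open>auto intro!: finite_UN_I\<close>)
  then show ?thesis by simp
qed

text \<open>The finite bound is uniform in \<open>N\<close>, so continuity from below
  applies.\<close>

lemma maximal_inequality:
  assumes F: "folner F" and C: "C \<ge> 0"
    and tempered: "\<And>n. real (card (set_prod (\<Union>k<n. set_inv (F k)) (F n))) \<le> C * real (card (F n))"
    and e: "integrable M e" "\<And>\<omega>. \<omega> \<in> space M \<Longrightarrow> e \<omega> \<ge> 0" and c: "c > 0"
  shows "prob {\<omega> \<in> space M. \<exists>k. avg F k e \<omega> > c} \<le> 2 * (1 + C) / c * (\<integral>\<omega>. e \<omega> \<partial>M)"
proof (rule LIMSEQ_le_const2)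
  have [measurable]: "e \<in> borel_measurable M" using e by simp
  let ?A = "\<lambda>N. {\<omega> \<in> space M. \<exists>k\<le>N. avg F k e \<omega> > c}"
  have "(\<lambda>N. prob (?A N)) \<longlonglongrightarrow> prob (\<Union>N. ?A N)"
    by (rule finite_Lim_measure_incseq) (auto simp: incseq_def intro: order_trans)
  also have "(\<Union>N. ?A N) = {\<omega> \<in> space M. \<exists>k. avg F k e \<omega> > c}" by auto
  finally show "(\<lambda>N. prob (?A N)) \<longlonglongrightarrow> prob {\<omega> \<in> space M. \<exists>k. avg F k e \<omega> > c}" .
  show "\<exists>N. \<forall>n\<ge>N. prob (?A n) \<le> 2 * (1 + C) / c * (\<integral>\<omega>. e \<omega> \<partial>M)"
    using maximal_inequality_finite[OF assms] by blast
qed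

end

section \<open>Mean convergence and pointwise convergence of averages\<close>

lemma abs_sum_diff_le:
  fixes v :: "'a \<Rightarrow> real"
  assumes "finite P" "finite Q" and v: "\<And>x. \<bar>v x\<bar> \<le> B"
  shows "\<bar>sum v P - sum v Q\<bar> \<le> B * real (card ((Q - P) \<union> (P - Q)))"
proof -
  have "sum v P - sum v Q = sum v (P - Q) - sum v (Q - P)"
    using sum.Int_Diff[OF assms(1), of v Q] sum.Int_Diff[OF assms(2), of v P]
    by (simp add: Int_commute)
  also have "\<bar>\<dots>\<bar> \<le> \<bar>sum v (P - Q)\<bar> + \<bar>sum v (Q - P)\<bar>" by simp
  also have "\<dots> \<le> real (card (P - Q)) * B + real (card (Q - P)) * B"
    using v by (intro add_mono order_trans[OF sum_abs] sum_bounded_above) auto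
  also have "\<dots> = B * real (card (Q - P) + card (P - Q))" by (simp add: algebra_simps)
  also have "card (Q - P) + card (P - Q) = card ((Q - P) \<union> (P - Q))"
    using assms by (intro card_Un_disjoint[symmetric]) auto
  finally show ?thesis .
qed

context pmp_action
begin

lemma invariant_AE_const:
  fixes \<phi> :: "'w \<Rightarrow> real"
  assumes erg: "ergodic_action M T" and int: "integrable M \<phi>"
    and inv: "\<And>g. AE \<omega> in M. \<phi> (T g \<omega>) = \<phi> \<omega>"
  shows "AE \<omega> in M. \<phi> \<omega> = (\<integral>\<omega>. \<phi> \<omega> \<partial>M)"
proof -
  have [measurable]: "\<phi> \<in> borel_measurable M" using int by simp
  define c where "c = (\<integral>\<omega>. \<phi> \<omega> \<partial>M)"
  \<comment> \<open>Ergodicity speaks of strictly invariant sets, while \<open>\<phi>\<close> is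
    invariant only almost everywhere. Asking for the inequality along the whole orbit makes the set
    strictly invariant and, the group being countable, changes it only by a null set.\<close>
  define A where "A = {\<omega> \<in> space M. \<forall>g. \<phi> (T g \<omega>) > c}"
  have A [measurable]: "A \<in> events" unfolding A_def by measurable
  have "T h -` A \<inter> space M = A" for h
  proof -
    have "(\<forall>g. c < \<phi> (T g (T h \<omega>))) \<longleftrightarrow> (\<forall>g. c < \<phi> (T g \<omega>))" if "\<omega> \<in> space M" for \<omega>
      using T_add[OF that, symmetric] by (metis diff_add_cancel)
    then show ?thesis unfolding A_def using T_space by auto
  qed
  then have zero_one: "prob A = 0 \<or> prob A = 1" using erg A unfolding ergodic_action_def by blast
  have all: "AE \<omega> in M. \<forall>g. \<phi> (T g \<omega>) = \<phi> \<omega>" using inv by (simp add: AE_all_countable)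
  have AE_A: "AE \<omega> in M. \<omega> \<in> A \<longleftrightarrow> \<phi> \<omega> > c"
    using all AE_space by eventually_elim (auto simp: A_def)
  have "prob A \<noteq> 1"
  proof
    assume "prob A = 1"
    then have "AE \<omega> in M. \<omega> \<in> A" using AE_prob_1 by blast
    with AE_A have "AE \<omega> in M. c < \<phi> \<omega>" by eventually_elim simp
    then have "(\<integral>\<omega>. c \<partial>M) < (\<integral>\<omega>. \<phi> \<omega> \<partial>M)"
      using int by (intro integral_less_AE_space) (auto simp: emeasure_space_1)
    then show False by (simp add: c_def prob_space)
  qed
  with zero_one have "prob A = 0" by simp
  then have "AE \<omega> in M. \<omega> \<notin> A" using A by (simp add: AE_iff_measurable[OF A] emeasure_eq_measure measure_nonneg AE_in_set_eq_1 prob_eq_0)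
  with AE_A have le: "AE \<omega> in M. 0 \<le> c - \<phi> \<omega>" by eventually_elim simp
  \<comment> \<open>A nonnegative function with integral 0 vanishes almost everywhere, so the lower
    bound needs no second superlevel set.\<close>
  have "(\<integral>\<omega>. c - \<phi> \<omega> \<partial>M) = 0" using int by (simp add: c_def prob_space)
  then have "AE \<omega> in M. c - \<phi> \<omega> = 0"
    using integral_nonneg_eq_0_iff_AE[OF _ le] int by auto
  then show ?thesis unfolding c_def by eventually_elim simp
qed

text \<open>Composing with \<open>T g\<close> replaces \<open>F k\<close> by its left translate, and
  for bounded \<open>u\<close> the symmetric difference contributes at most \<open>B\<close> times
  the Folner defect. The convergence holds at every point.\<close>

lemma avg_translate_diff:
  assumes F: "folner F" and \<omega>: "\<omega> \<in> space M" and u: "\<And>\<omega>. \<omega> \<in> space M \<Longrightarrow> \<bar>u \<omega>\<bar> \<le> B"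
  shows "(\<lambda>k. avg F k (\<lambda>\<omega>. u (T g \<omega>)) \<omega> - avg F k u \<omega>) \<longlonglongrightarrow> 0"
proof (rule Lim_null_comparison)
  show "(\<lambda>k. B * folner_defect F g k) \<longlonglongrightarrow> 0"
    using tendsto_mult_left[OF folnerD(4)[OF F, of g], of B] by simp
  have "norm (avg F k (\<lambda>\<omega>. u (T g \<omega>)) \<omega> - avg F k u \<omega>) \<le> B * folner_defect F g k" for k
  proof -
    have "(\<Sum>a\<in>F k. u (T g (T a \<omega>))) = (\<Sum>x\<in>left_translate g (F k). u (T x \<omega>))"
      unfolding left_translate_def by (subst sum.reindex) (auto simp: inj_on_def T_add \<omega>)
    then have "norm (avg F k (\<lambda>\<omega>. u (T g \<omega>)) \<omega> - avg F k u \<omega>) =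
        \<bar>(\<Sum>x\<in>left_translate g (F k). u (T x \<omega>)) - (\<Sum>x\<in>F k. u (T x \<omega>))\<bar> / real (card (F k))"
      unfolding avg_def by (simp add: diff_divide_distrib[symmetric])
    also have "\<dots> \<le> (B * real (card ((F k - left_translate g (F k)) \<union> (left_translate g (F k) - F k)))) / real (card (F k))"
      using u T_space[OF \<omega>] folnerD(1)[OF F, of k]
      by (intro divide_right_mono abs_sum_diff_le finite_left_translate) auto
    finally show ?thesis unfolding folner_defect_def by simp
  qed
  then show "\<forall>\<^sub>F k in sequentially. norm (avg F k (\<lambda>\<omega>. u (T g \<omega>)) \<omega> - avg F k u \<omega>)
      \<le> B * folner_defect F g k" by simp
qed

lemma integrable_bounded:
  fixes u :: "'w \<Rightarrow> real"
  shows "u \<in> borel_measurable M \<Longrightarrow> (\<And>\<omega>. \<omega> \<in> space M \<Longrightarrow> \<bar>u \<omega>\<bar> \<le> B) \<Longrightarrow> integrable M u"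
  by (rule integrable_const_bound[of _ B]) auto

text \<open>The total variation of the sequence has finite integral by monotone convergence, hence
  is finite almost everywhere, and the telescoping series converges absolutely there.\<close>

lemma L1_summable_AE_convergent:
  fixes u :: "nat \<Rightarrow> 'w \<Rightarrow> real"
  assumes int: "\<And>n. integrable M (u n)"
    and sum: "summable (\<lambda>n. \<integral>\<omega>. \<bar>u (Suc n) \<omega> - u n \<omega>\<bar> \<partial>M)"
  shows "AE \<omega> in M. convergent (\<lambda>n. u n \<omega>)"
proof -
  have [measurable]: "u n \<in> borel_measurable M" for n using int by auto
  let ?w = "\<lambda>n \<omega>. \<bar>u (Suc n) \<omega> - u n \<omega>\<bar>"
  have "(\<integral>\<^sup>+\<omega>. (\<Sum>n. ennreal (?w n \<omega>)) \<partial>M) = (\<Sum>n. \<integral>\<^sup>+\<omega>. ennreal (?w n \<omega>) \<partial>M)"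
    by (rule nn_integral_suminf) measurable
  also have "\<dots> = (\<Sum>n. ennreal (\<integral>\<omega>. ?w n \<omega> \<partial>M))"
    using int by (intro suminf_cong nn_integral_eq_integral) auto
  also have "\<dots> = ennreal (\<Sum>n. \<integral>\<omega>. ?w n \<omega> \<partial>M)"
    by (intro suminf_ennreal2 sum) auto
  finally have "(\<integral>\<^sup>+\<omega>. (\<Sum>n. ennreal (?w n \<omega>)) \<partial>M) \<noteq> \<infinity>" by simp
  then have "AE \<omega> in M. (\<Sum>n. ennreal (?w n \<omega>)) \<noteq> \<infinity>"
    by (intro nn_integral_noteq_infinite) measurable
  then show ?thesis
  proof eventually_elim
    case (elim \<omega>)
    then have "summable (\<lambda>n. ?w n \<omega>)" by (intro summable_suminf_not_top) auto
    then have "summable (\<lambda>n. u (Suc n) \<omega> - u n \<omega>)" by (rule summable_rabs_cancel)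
    then have "convergent (\<lambda>n. \<Sum>i<n. u (Suc i) \<omega> - u i \<omega>)" by (simp add: summable_iff_convergent)
    from convergent_add[OF this convergent_const[of "u 0 \<omega>"]]
    show ?case by (simp add: sum_lessThan_telescope[of "\<lambda>n. u n \<omega>"])
  qed
qed

text \<open>Among the bounded functions \<open>u\<close> with the same integral and asymptotically the same averages
  as \<open>f\<close> -- a convex set invariant under the action -- the \<open>L2\<close>-minimal one is invariant by
  uniqueness, hence constant.\<close>

lemma mean_ergodic:
  assumes erg: "ergodic_action M T" and F: "folner F"
    and f: "f \<in> borel_measurable M" "\<And>\<omega>. \<omega> \<in> space M \<Longrightarrow> \<bar>f \<omega>\<bar> \<le> B" and \<epsilon>: "\<epsilon> > 0"
  obtains u where "u \<in> borel_measurable M" "\<And>\<omega>. \<omega> \<in> space M \<Longrightarrow> \<bar>u \<omega>\<bar> \<le> B"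
    "\<And>\<omega>. \<omega> \<in> space M \<Longrightarrow> (\<lambda>k. avg F k f \<omega> - avg F k u \<omega>) \<longlonglongrightarrow> 0"
    "(\<integral>\<omega>. \<bar>u \<omega> - (\<integral>\<omega>. f \<omega> \<partial>M)\<bar> \<partial>M) < \<epsilon>"
proof -
  define c where "c = (\<integral>\<omega>. f \<omega> \<partial>M)"
  define H where "H u \<longleftrightarrow> u \<in> borel_measurable M \<and> (\<forall>\<omega>\<in>space M. \<bar>u \<omega>\<bar> \<le> B) \<and> (\<integral>\<omega>. u \<omega> \<partial>M) = c \<and>
      (\<forall>\<omega>\<in>space M. (\<lambda>k. avg F k f \<omega> - avg F k u \<omega>) \<longlonglongrightarrow> 0)" for u
  have HD: "u \<in> borel_measurable M" "\<And>\<omega>. \<omega> \<in> space M \<Longrightarrow> \<bar>u \<omega>\<bar> \<le> B" "integrable M u"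
    "integrable M (\<lambda>\<omega>. (u \<omega>)\<^sup>2)" "(\<integral>\<omega>. u \<omega> \<partial>M) = c" if "H u" for u
  proof -
    show u: "u \<in> borel_measurable M" "\<And>\<omega>. \<omega> \<in> space M \<Longrightarrow> \<bar>u \<omega>\<bar> \<le> B" "(\<integral>\<omega>. u \<omega> \<partial>M) = c"
      using that unfolding H_def by auto
    then show "integrable M u" by (intro integrable_bounded)
    have "\<bar>(u \<omega>)\<^sup>2\<bar> \<le> B\<^sup>2" if "\<omega> \<in> space M" for \<omega>
      using power_mono[OF u(2)[OF that], of 2] by simp
    then show "integrable M (\<lambda>\<omega>. (u \<omega>)\<^sup>2)" using u(1) by (intro integrable_bounded) auto
  qed
  have Hf: "H f" unfolding H_def c_def using f by auto
  have HT: "H (\<lambda>\<omega>. u (T g \<omega>))" if "H u" for u g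
    unfolding H_def
  proof (intro conjI ballI)
    note [measurable] = HD(1)[OF that]
    show "(\<lambda>\<omega>. u (T g \<omega>)) \<in> borel_measurable M" by measurable
    show "(\<integral>\<omega>. u (T g \<omega>) \<partial>M) = c" using HD[OF that] by (simp add: integral_T)
    fix \<omega> assume \<omega>: "\<omega> \<in> space M"
    show "\<bar>u (T g \<omega>)\<bar> \<le> B" using HD[OF that] T_space[OF \<omega>] by blast
    have "(\<lambda>k. (avg F k f \<omega> - avg F k u \<omega>) - (avg F k (\<lambda>\<omega>. u (T g \<omega>)) \<omega> - avg F k u \<omega>)) \<longlonglongrightarrow> 0 - 0"
      using that \<omega> HD(2)[OF that] unfolding H_def by (intro tendsto_diff avg_translate_diff[OF F]) auto
    then show "(\<lambda>k. avg F k f \<omega> - avg F k (\<lambda>\<omega>. u (T g \<omega>)) \<omega>) \<longlonglongrightarrow> 0" by simp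
  qed
  have Hmid: "H (\<lambda>\<omega>. (u \<omega> + v \<omega>) / 2)" if "H u" "H v" for u v
    unfolding H_def
  proof (intro conjI ballI)
    note [measurable] = HD(1)[OF that(1)] HD(1)[OF that(2)]
    show "(\<lambda>\<omega>. (u \<omega> + v \<omega>) / 2) \<in> borel_measurable M" by measurable
    show "(\<integral>\<omega>. (u \<omega> + v \<omega>) / 2 \<partial>M) = c" using HD[OF that(1)] HD[OF that(2)] by simp
    fix \<omega> assume \<omega>: "\<omega> \<in> space M"
    show "\<bar>(u \<omega> + v \<omega>) / 2\<bar> \<le> B" using HD(2)[OF that(1) \<omega>] HD(2)[OF that(2) \<omega>]
      abs_triangle_ineq[of "u \<omega>" "v \<omega>"] by simp
    have "(\<lambda>k. ((avg F k f \<omega> - avg F k u \<omega>) + (avg F k f \<omega> - avg F k v \<omega>)) / 2) \<longlonglongrightarrow> (0 + 0) / 2"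
      using that \<omega> unfolding H_def by (intro tendsto_divide tendsto_add) auto
    moreover have "avg F k (\<lambda>\<omega>. (u \<omega> + v \<omega>) / 2) \<omega> = (avg F k u \<omega> + avg F k v \<omega>) / 2" for k
      unfolding avg_def sum_divide_distrib[symmetric] sum.distrib
      by (simp add: add_divide_distrib)
    then have "avg F k f \<omega> - avg F k (\<lambda>\<omega>. (u \<omega> + v \<omega>) / 2) \<omega> =
        ((avg F k f \<omega> - avg F k u \<omega>) + (avg F k f \<omega> - avg F k v \<omega>)) / 2" for k
      by (simp add: field_simps)
    ultimately show "(\<lambda>k. avg F k f \<omega> - avg F k (\<lambda>\<omega>. (u \<omega> + v \<omega>) / 2) \<omega>) \<longlonglongrightarrow> 0"
      by (simp only: add_0_left div_0)
  qed
  define Q where "Q u = (\<integral>\<omega>. (u \<omega>)\<^sup>2 \<partial>M)" for u :: "'w \<Rightarrow> real"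
  define d where "d = (INF u\<in>Collect H. Q u)"
  have bdd: "bdd_below (Q ` Collect H)" unfolding Q_def by (intro bdd_belowI2[of _ 0]) simp
  have d_le: "d \<le> Q u" if "H u" for u
    unfolding d_def using that by (intro cINF_lower bdd) simp
  \<comment> \<open>Uniform convexity: by the parallelogram identity and the minimality of
    \<open>d\<close>, two near-minimisers whose midpoint stays in \<open>H\<close> are close. The
    bound \<open>\<bar>x\<bar> \<le> x\<^sup>2 / (2 * t) + t / 2\<close> passes from squares to the
    \<open>L1\<close> distance directly.\<close>
  have near: "(\<integral>\<omega>. \<bar>u \<omega> - v \<omega>\<bar> \<partial>M) \<le> t"
    if u: "H u" "Q u \<le> d + t\<^sup>2 / 4" and v: "H v" "Q v \<le> d + t\<^sup>2 / 4" and t: "t > 0" for u v t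
  proof -
    note [simp] = HD(3,4)[OF u(1)] HD(3,4)[OF v(1)] HD(3,4)[OF Hmid[OF u(1) v(1)]]
    have "(\<integral>\<omega>. \<bar>u \<omega> - v \<omega>\<bar> \<partial>M) \<le>
        (\<integral>\<omega>. ((u \<omega>)\<^sup>2 + (v \<omega>)\<^sup>2 - 2 * ((u \<omega> + v \<omega>) / 2)\<^sup>2) / t + t / 2 \<partial>M)"
    proof (intro integral_mono)
      fix \<omega>
      have "0 \<le> (\<bar>u \<omega> - v \<omega>\<bar> - t)\<^sup>2" by simp
      then have "\<bar>u \<omega> - v \<omega>\<bar> \<le> (u \<omega> - v \<omega>)\<^sup>2 / (2 * t) + t / 2"
        using t by (simp add: power2_diff field_simps power2_eq_square)
      also have "(u \<omega> - v \<omega>)\<^sup>2 / (2 * t) = ((u \<omega>)\<^sup>2 + (v \<omega>)\<^sup>2 - 2 * ((u \<omega> + v \<omega>) / 2)\<^sup>2) / t"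
        using t by (simp add: field_simps power2_eq_square)
      finally show "\<bar>u \<omega> - v \<omega>\<bar> \<le> ((u \<omega>)\<^sup>2 + (v \<omega>)\<^sup>2 - 2 * ((u \<omega> + v \<omega>) / 2)\<^sup>2) / t + t / 2" .
    qed (intro Bochner_Integration.integrable_add Bochner_Integration.integrable_diff
        integrable_divide_zero integrable_mult_right integrable_abs; simp)+
    also have "\<dots> = (Q u + Q v - 2 * Q (\<lambda>\<omega>. (u \<omega> + v \<omega>) / 2)) / t + t / 2"
      unfolding Q_def by (simp add: prob_space del: power_divide)
    also have "\<dots> \<le> (t\<^sup>2 / 2) / t + t / 2"
      using u v d_le[OF Hmid[OF u(1) v(1)]] t by (intro add_mono divide_right_mono) auto
    also have "\<dots> = t" using t by (simp add: power2_eq_square)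
    finally show ?thesis .
  qed
  \<comment> \<open>Geometric tolerances make the \<open>L1\<close> steps of the minimising sequence
    summable, so the sequence itself converges almost everywhere without passing to a
    subsequence.\<close>
  define t where "t n = (1/2 :: real) ^ n" for n
  have t: "t n > 0" "t (Suc n) \<le> t n" for n by (auto simp: t_def)
  have "\<exists>u. H u \<and> Q u \<le> d + (t n)\<^sup>2 / 4" for n
  proof -
    have "d < d + (t n)\<^sup>2 / 4" using t(1)[of n] by simp
    then obtain y where "y \<in> Q ` Collect H" "y < d + (t n)\<^sup>2 / 4"
      unfolding d_def using cInf_lessD[of "Q ` Collect H"] Hf by blast
    then show ?thesis by auto
  qed
  then obtain u where u: "\<And>n. H (u n)" "\<And>n. Q (u n) \<le> d + (t n)\<^sup>2 / 4" by metis
  note [measurable] = HD(1)[OF u(1)]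
  have step: "(\<integral>\<omega>. \<bar>u (Suc n) \<omega> - u n \<omega>\<bar> \<partial>M) \<le> t n" for n
  proof (rule near[OF u(1) _ u t(1)])
    have "(t (Suc n))\<^sup>2 \<le> (t n)\<^sup>2" using t(1)[of "Suc n"] t(2)[of n] by (intro power_mono) auto
    then show "Q (u (Suc n)) \<le> d + (t n)\<^sup>2 / 4" using u(2)[of "Suc n"] by linarith
  qed
  have "summable t" unfolding t_def[abs_def] by (intro summable_geometric) simp
  then have summ: "summable (\<lambda>n. \<integral>\<omega>. \<bar>u (Suc n) \<omega> - u n \<omega>\<bar> \<partial>M)"
  proof (rule summable_comparison_test'[of t 0])
    fix n
    show "norm (\<integral>\<omega>. \<bar>u (Suc n) \<omega> - u n \<omega>\<bar> \<partial>M) \<le> t n"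
      using step[of n] by simp
  qed
  have "AE \<omega> in M. convergent (\<lambda>n. u n \<omega>)"
    by (rule L1_summable_AE_convergent[OF HD(3)[OF u(1)] summ])
  moreover define \<phi> where "\<phi> \<omega> = lim (\<lambda>n. u n \<omega>)" for \<omega>
  ultimately have lim: "AE \<omega> in M. (\<lambda>n. u n \<omega>) \<longlonglongrightarrow> \<phi> \<omega>"
    by (simp add: convergent_LIMSEQ_iff)
  have \<phi> [measurable]: "\<phi> \<in> borel_measurable M" unfolding \<phi>_def[abs_def] by measurable
  have bound: "AE \<omega> in M. norm (u n \<omega>) \<le> B" for n using HD(2)[OF u(1)] by auto
  have int\<phi>: "integrable M \<phi>"
    by (rule integrable_dominated_convergence[where w = "\<lambda>_. B" and s = u]) (use lim bound in auto)
  have "(\<lambda>n. \<integral>\<omega>. u n \<omega> \<partial>M) \<longlonglongrightarrow> (\<integral>\<omega>. \<phi> \<omega> \<partial>M)"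
    by (rule integral_dominated_convergence[where w = "\<lambda>_. B"]) (use lim bound in auto)
  then have "(\<integral>\<omega>. \<phi> \<omega> \<partial>M) = c" using HD(5)[OF u(1)] by (simp add: LIMSEQ_const_iff)
  moreover have "AE \<omega> in M. \<phi> (T g \<omega>) = \<phi> \<omega>" for g
  proof -
    have "AE \<omega> in M. (\<lambda>n. \<bar>u n (T g \<omega>) - u n \<omega>\<bar>) \<longlonglongrightarrow> \<bar>\<phi> (T g \<omega>) - \<phi> \<omega>\<bar>"
      using lim AE_T[OF lim, of g] by eventually_elim (intro tendsto_intros)
    moreover have "AE \<omega> in M. norm \<bar>u n (T g \<omega>) - u n \<omega>\<bar> \<le> 2 * B" for n
      using bound[of n] AE_T[OF bound, of n g] by eventually_elim auto
    ultimately have "(\<lambda>n. \<integral>\<omega>. \<bar>u n (T g \<omega>) - u n \<omega>\<bar> \<partial>M) \<longlonglongrightarrow> (\<integral>\<omega>. \<bar>\<phi> (T g \<omega>) - \<phi> \<omega>\<bar> \<partial>M)"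
      by (intro integral_dominated_convergence[where w = "\<lambda>_. 2 * B"]) auto
    moreover have "(\<lambda>n. \<integral>\<omega>. \<bar>u n (T g \<omega>) - u n \<omega>\<bar> \<partial>M) \<longlonglongrightarrow> 0"
    proof (rule Lim_null_comparison)
      show "t \<longlonglongrightarrow> 0" unfolding t_def[abs_def] by (rule LIMSEQ_power_zero) simp
      \<comment> \<open>The translate of \<open>u n\<close> lies in \<open>H\<close> with the same
        \<open>L2\<close> norm, hence is an equally good near-minimiser; \<open>near\<close> then
        forces both to the same limit.\<close>
      have "Q (\<lambda>\<omega>. u n (T g \<omega>)) = Q (u n)" for n
        unfolding Q_def by (rule integral_T[of "\<lambda>\<omega>. (u n \<omega>)\<^sup>2"]) measurable
      then have "(\<integral>\<omega>. \<bar>u n (T g \<omega>) - u n \<omega>\<bar> \<partial>M) \<le> t n" for n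
        using u by (intro near HT t) auto
      then show "\<forall>\<^sub>F n in sequentially. norm (\<integral>\<omega>. \<bar>u n (T g \<omega>) - u n \<omega>\<bar> \<partial>M) \<le> t n" by simp
    qed
    ultimately have "(\<integral>\<omega>. \<bar>\<phi> (T g \<omega>) - \<phi> \<omega>\<bar> \<partial>M) = 0" using LIMSEQ_unique by blast
    then have "AE \<omega> in M. \<bar>\<phi> (T g \<omega>) - \<phi> \<omega>\<bar> = 0"
      using integrable_T[OF int\<phi>] int\<phi> by (subst (asm) integral_nonneg_eq_0_iff_AE) auto
    then show ?thesis by eventually_elim simp
  qed
  ultimately have "AE \<omega> in M. \<phi> \<omega> = c" using invariant_AE_const[OF erg int\<phi>] by simp
  with lim have "AE \<omega> in M. (\<lambda>n. \<bar>u n \<omega> - c\<bar>) \<longlonglongrightarrow> 0"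
    by eventually_elim (auto intro!: tendsto_eq_intros)
  moreover have "AE \<omega> in M. norm \<bar>u n \<omega> - c\<bar> \<le> B + \<bar>c\<bar>" for n
    using bound[of n] by eventually_elim auto
  ultimately have "(\<lambda>n. \<integral>\<omega>. \<bar>u n \<omega> - c\<bar> \<partial>M) \<longlonglongrightarrow> (\<integral>\<omega>. 0 \<partial>M)"
    by (intro integral_dominated_convergence[where w = "\<lambda>_. B + \<bar>c\<bar>"]) auto
  then have "(\<lambda>n. \<integral>\<omega>. \<bar>u n \<omega> - c\<bar> \<partial>M) \<longlonglongrightarrow> 0" by simp
  \<comment> \<open>The function returned is a late \<open>u n\<close>: it lies in \<open>H\<close>,
    and by now its \<open>L1\<close> distance to the constant is known to be small.\<close>
  then have "\<forall>\<^sub>F n in sequentially. (\<integral>\<omega>. \<bar>u n \<omega> - c\<bar> \<partial>M) < \<epsilon>" using \<epsilon> by (rule order_tendstoD)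
  then obtain n where "(\<integral>\<omega>. \<bar>u n \<omega> - c\<bar> \<partial>M) < \<epsilon>" using eventually_happens by force
  then show thesis using that[of "u n"] u(1)[of n] unfolding H_def c_def by auto
qed

text \<open>Replace \<open>f\<close> by a function \<open>u\<close> with the same asymptotic
  averages that is \<open>L1\<close>-close to the mean \<open>c\<close>. The maximal inequality for
  \<open>\<bar>u - c\<bar>\<close> makes large averages improbable; letting first the probability
  and then the deviation tend to 0 gives the limit.\<close>

theorem pointwise_ergodic:
  assumes erg: "ergodic_action M T" and F: "tempered_folner F"
    and f: "f \<in> borel_measurable M" "\<And>\<omega>. \<omega> \<in> space M \<Longrightarrow> \<bar>f \<omega>\<bar> \<le> B"
  shows "AE \<omega> in M. (\<lambda>k. avg F k f \<omega>) \<longlonglongrightarrow> (\<integral>\<omega>. f \<omega> \<partial>M)"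
proof -
  note [measurable] = f(1)
  define c where "c = (\<integral>\<omega>. f \<omega> \<partial>M)"
  from F have fol: "folner F" unfolding tempered_folner_def by simp
  from F obtain C0 where C0: "\<And>n. real (card (set_prod (\<Union>k<n. set_inv (F k)) (F n))) \<le> C0 * real (card (F n))"
    unfolding tempered_folner_def by blast
  define C where "C = max C0 0"
  have C: "C \<ge> 0" "\<And>n. real (card (set_prod (\<Union>k<n. set_inv (F k)) (F n))) \<le> C * real (card (F n))"
    unfolding C_def by (simp, rule order_trans[OF C0], simp add: mult_right_mono)
  have "AE \<omega> in M. \<exists>N. \<forall>k\<ge>N. \<bar>avg F k f \<omega> - c\<bar> < 2 * \<epsilon>" if \<epsilon>: "\<epsilon> > 0" for \<epsilon>
  proof -
    let ?P = "\<lambda>\<omega>. \<exists>N. \<forall>k\<ge>N. \<bar>avg F k f \<omega> - c\<bar> < 2 * \<epsilon>"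
    have "prob {\<omega> \<in> space M. \<not> ?P \<omega>} \<le> \<delta>" if \<delta>: "\<delta> > 0" for \<delta>
    proof -
      \<comment> \<open>Chosen so that the bound of the maximal inequality at level
        \<open>\<epsilon>\<close> becomes exactly \<open>\<delta>\<close>.\<close>
      define \<eta> where "\<eta> = \<delta> / (2 * (1 + C) / \<epsilon>)"
      have "\<eta> > 0" unfolding \<eta>_def using \<delta> \<epsilon> C(1) by simp
      from mean_ergodic[OF erg fol f this] obtain u
        where u [measurable]: "u \<in> borel_measurable M" and ub: "\<And>\<omega>. \<omega> \<in> space M \<Longrightarrow> \<bar>u \<omega>\<bar> \<le> B"
        and fu: "\<And>\<omega>. \<omega> \<in> space M \<Longrightarrow> (\<lambda>k. avg F k f \<omega> - avg F k u \<omega>) \<longlonglongrightarrow> 0"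
        and uc: "(\<integral>\<omega>. \<bar>u \<omega> - c\<bar> \<partial>M) < \<eta>" unfolding c_def by blast
      let ?e = "\<lambda>\<omega>. \<bar>u \<omega> - c\<bar>"
      \<comment> \<open>One \<open>\<epsilon>\<close> comes from exchanging \<open>f\<close> for
        \<open>u\<close> at late times, the other from the average of
        \<open>\<bar>u - c\<bar>\<close>; together they account for
        \<open>2 * \<epsilon>\<close>.\<close>
      have imp: "?P \<omega>" if \<omega>: "\<omega> \<in> space M" and small: "\<forall>k. \<not> avg F k ?e \<omega> > \<epsilon>" for \<omega>
      proof -
        from fu[OF \<omega>] \<epsilon> obtain N where N: "\<And>k. k \<ge> N \<Longrightarrow> \<bar>avg F k f \<omega> - avg F k u \<omega>\<bar> < \<epsilon>"
          unfolding LIMSEQ_iff by auto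
        have close: "\<bar>avg F k f \<omega> - c\<bar> < 2 * \<epsilon>" if "k \<ge> N" for k
        proof -
          have "avg F k u \<omega> - c = (\<Sum>g\<in>F k. u (T g \<omega>) - c) / real (card (F k))"
            unfolding avg_def using folnerD(3)[OF fol, of k] by (simp add: sum_subtractf field_simps)
          then have "\<bar>avg F k u \<omega> - c\<bar> \<le> avg F k ?e \<omega>"
            unfolding avg_def by (simp add: divide_right_mono sum_abs)
          moreover have "avg F k ?e \<omega> \<le> \<epsilon>" using small by (simp add: not_less)
          ultimately show ?thesis using N[OF that] by linarith
        qed
        show ?thesis by (intro exI[of _ N] allI impI close)
      qed
      have "{\<omega> \<in> space M. \<not> ?P \<omega>} \<subseteq> {\<omega> \<in> space M. \<exists>k. avg F k ?e \<omega> > \<epsilon>}"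
      proof (rule subsetI)
        fix \<omega> assume a: "\<omega> \<in> {\<omega> \<in> space M. \<not> ?P \<omega>}"
        then have \<omega>: "\<omega> \<in> space M" and nP: "\<not> ?P \<omega>" by simp_all
        have "\<not> (\<forall>k. \<not> avg F k ?e \<omega> > \<epsilon>)"
        proof
          assume "\<forall>k. \<not> avg F k ?e \<omega> > \<epsilon>"
          from imp[OF \<omega> this] nP show False by contradiction
        qed
        with \<omega> show "\<omega> \<in> {\<omega> \<in> space M. \<exists>k. avg F k ?e \<omega> > \<epsilon>}" by simp
      qed
      then have "prob {\<omega> \<in> space M. \<not> ?P \<omega>} \<le> prob {\<omega> \<in> space M. \<exists>k. avg F k ?e \<omega> > \<epsilon>}"
        by (intro finite_measure_mono) measurable
      moreover have "prob {\<omega> \<in> space M. \<exists>k. avg F k ?e \<omega> > \<epsilon>} \<le> 2 * (1 + C) / \<epsilon> * (\<integral>\<omega>. ?e \<omega> \<partial>M)"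
        by (rule maximal_inequality[OF fol C _ _ \<epsilon>]) (use integrable_bounded[OF u ub] in simp_all)
      moreover have "2 * (1 + C) / \<epsilon> * (\<integral>\<omega>. ?e \<omega> \<partial>M) \<le> 2 * (1 + C) / \<epsilon> * \<eta>"
        using uc \<epsilon> C(1) by (intro mult_left_mono) auto
      moreover have "2 * (1 + C) / \<epsilon> * \<eta> = \<delta>" unfolding \<eta>_def using \<epsilon> C(1) by simp
      ultimately show ?thesis by linarith
    qed
    then have "prob {\<omega> \<in> space M. \<not> ?P \<omega>} \<le> 0" by (rule field_le_epsilon) simp
    then have "prob {\<omega> \<in> space M. \<not> ?P \<omega>} = 0" using measure_nonneg by (rule antisym)
    then show ?thesis by (subst AE_iff_measurable[OF _ refl]) (auto simp: emeasure_eq_measure)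
  qed
  then have "AE \<omega> in M. \<forall>n. \<exists>N. \<forall>k\<ge>N. \<bar>avg F k f \<omega> - c\<bar> < 2 * inverse (real (Suc n))"
    by (subst AE_all_countable) simp
  then show ?thesis
  proof eventually_elim
    case (elim \<omega>)
    show ?case unfolding c_def[symmetric] LIMSEQ_iff
    proof (intro allI impI)
      fix r :: real assume "r > 0"
      then obtain n where "inverse (real (Suc n)) < r / 2" using reals_Archimedean[of "r / 2"] by auto
      then show "\<exists>N. \<forall>k\<ge>N. norm (avg F k f \<omega> - c) < r" using elim[rule_format, of n] by fastforce
    qed
  qed
qed

end

section \<open>Counting typical patterns\<close>

text \<open>Arithmetic-geometric means: divide by the mean \<open>a\<close> and sum
  \<open>ln y \<le> y - 1\<close> over \<open>y = x g / a\<close>, where the right sides add up to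
  0. A vanishing factor is split off before logarithms are taken.\<close>

lemma prod_root_le_mean:
  fixes x :: "'i \<Rightarrow> real"
  assumes G: "card G = m" "m > 0" and x: "\<And>g. g \<in> G \<Longrightarrow> x g \<ge> 0"
  shows "(\<Prod>g\<in>G. root m (x g)) \<le> (\<Sum>g\<in>G. x g) / m"
proof (cases "\<exists>g\<in>G. x g = 0")
  case True
  have "finite G" using G card_gt_0_iff by metis
  then have "(\<Prod>g\<in>G. root m (x g)) = 0" using True by (intro prod_zero) force+
  then show ?thesis using x by (simp add: sum_nonneg)
next
  case False
  have fin: "finite G" using G card_gt_0_iff by metis
  have pos: "x g > 0" if "g \<in> G" for g using False x that by (force simp: less_le)
  define a where "a = (\<Sum>g\<in>G. x g) / m"
  have "G \<noteq> {}" using G by auto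
  then have "(\<Sum>g\<in>G. x g) > 0" using fin pos by (intro sum_pos)
  then have a: "a > 0" and ma: "(\<Sum>g\<in>G. x g) = m * a" unfolding a_def using G by auto
  have "(\<Sum>g\<in>G. ln (x g / a)) \<le> (\<Sum>g\<in>G. x g / a - 1)"
    using pos a by (intro sum_mono ln_le_minus_one) simp
  also have "\<dots> = 0" using a ma G by (simp add: sum_subtractf sum_divide_distrib[symmetric])
  finally have "(\<Sum>g\<in>G. ln (x g / a)) \<le> 0" .
  moreover have "(\<Sum>g\<in>G. ln (x g / a)) = (\<Sum>g\<in>G. ln (x g) - ln a)"
  proof (intro sum.cong refl)
    fix g assume "g \<in> G"
    from pos[OF this] a show "ln (x g / a) = ln (x g) - ln a" by (simp add: ln_div)
  qed
  ultimately have "(\<Sum>g\<in>G. ln (x g)) \<le> m * ln a" using G by (simp add: sum_subtractf)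
  then have le: "(\<Sum>g\<in>G. ln (x g)) / m \<le> ln a" using G by (simp add: field_simps)
  have "(\<Prod>g\<in>G. root m (x g)) = (\<Prod>g\<in>G. exp (ln (x g) / m))"
  proof (intro prod.cong refl)
    fix g assume "g \<in> G"
    from pos[OF this] G show "root m (x g) = exp (ln (x g) / m)"
      by (simp add: root_powr_inverse powr_def)
  qed
  also have "\<dots> = exp ((\<Sum>g\<in>G. ln (x g)) / m)"
    using fin by (simp add: exp_sum sum_divide_distrib)
  also have "\<dots> \<le> exp (ln a)" using le by simp
  finally show ?thesis using a unfolding a_def by simp
qed

text \<open>Holder's inequality with \<open>m\<close> equal exponents. Normalise every
  \<open>u g\<close> to total mass 1 and apply the arithmetic-geometric mean inequality at each
  \<open>s\<close>; the resulting bounds sum to 1. A family of total mass 0 makes the left side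
  vanish.\<close>

lemma generalized_Holder_sum:
  fixes u :: "'i \<Rightarrow> 's \<Rightarrow> real"
  assumes G: "card G = m" "m > 0" and Z: "finite Z"
    and u: "\<And>g s. g \<in> G \<Longrightarrow> s \<in> Z \<Longrightarrow> u g s \<ge> 0"
  shows "(\<Sum>s\<in>Z. \<Prod>g\<in>G. root m (u g s)) \<le> (\<Prod>g\<in>G. root m (\<Sum>s\<in>Z. u g s))"
proof -
  have fin: "finite G" using G card_gt_0_iff by metis
  define c where "c g = (\<Sum>s\<in>Z. u g s)" for g
  have c0: "c g \<ge> 0" if "g \<in> G" for g unfolding c_def using u that by (intro sum_nonneg)
  show ?thesis
  proof (cases "\<exists>g\<in>G. c g = 0")
    case True
    then obtain g where g: "g \<in> G" "c g = 0" by blast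
    then have "u g s = 0" if "s \<in> Z" for s
      using sum_nonneg_eq_0_iff[OF Z, of "u g"] u that unfolding c_def by auto
    then have "(\<Prod>g\<in>G. root m (u g s)) = 0" if "s \<in> Z" for s
      using g(1) that by (intro prod_zero[OF fin] bexI[of _ g]) simp_all
    then have "(\<Sum>s\<in>Z. \<Prod>g\<in>G. root m (u g s)) = 0" by simp
    moreover have "0 \<le> (\<Prod>g\<in>G. root m (c g))" using c0 by (intro prod_nonneg real_root_ge_zero)
    ultimately show ?thesis unfolding c_def by simp
  next
    case False
    then have c: "c g > 0" if "g \<in> G" for g using c0 that by (force simp: less_le)
    have "(\<Sum>s\<in>Z. \<Prod>g\<in>G. root m (u g s)) = (\<Sum>s\<in>Z. (\<Prod>g\<in>G. root m (c g)) * (\<Prod>g\<in>G. root m (u g s / c g)))"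
    proof (intro sum.cong refl)
      fix s
      have "root m (u g s) = root m (c g) * root m (u g s / c g)" if "g \<in> G" for g
        using c[OF that] by (simp add: real_root_mult[symmetric])
      then show "(\<Prod>g\<in>G. root m (u g s)) = (\<Prod>g\<in>G. root m (c g)) * (\<Prod>g\<in>G. root m (u g s / c g))"
        by (simp add: prod.distrib[symmetric])
    qed
    also have "\<dots> = (\<Prod>g\<in>G. root m (c g)) * (\<Sum>s\<in>Z. \<Prod>g\<in>G. root m (u g s / c g))"
      by (simp add: sum_distrib_left)
    also have "\<dots> \<le> (\<Prod>g\<in>G. root m (c g)) * (\<Sum>s\<in>Z. (\<Sum>g\<in>G. u g s / c g) / m)"
      using c0 u by (intro mult_left_mono sum_mono prod_root_le_mean G prod_nonneg real_root_ge_zero) auto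
    also have "(\<Sum>s\<in>Z. (\<Sum>g\<in>G. u g s / c g) / m) = (\<Sum>g\<in>G. (\<Sum>s\<in>Z. u g s) / c g) / m"
      unfolding sum_divide_distrib[symmetric] by (subst sum.swap) (simp add: sum_divide_distrib)
    also have "\<dots> = 1"
      unfolding c_def[symmetric] using c G by (simp add: less_imp_neq[THEN not_sym])
    finally show ?thesis unfolding c_def by simp
  qed
qed

text \<open>In the counting of typical patterns this plays the part of Shearer's inequality for entropies, so
  that no tilings are needed.\<close>

lemma (in prob_space) Finner_cylinders:
  fixes Y :: "'i \<Rightarrow> 'a \<Rightarrow> 's::finite"
  assumes Y [measurable]: "\<And>i. Y i \<in> measurable M (count_space UNIV)"
    and P: "finite P" and D: "finite D" and m: "m > 0"
    and cover: "\<And>p. p \<in> P \<Longrightarrow> card {g \<in> D. p \<in> S g} = m"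
  shows "(\<Sum>y\<in>P \<rightarrow>\<^sub>E UNIV. \<Prod>g\<in>D. root m (prob {\<omega> \<in> space M. \<forall>p\<in>S g \<inter> P. Y p \<omega> = y p})) \<le> 1"
  using P cover
proof (induction P rule: finite_induct)
  case empty
  then show ?case using m by (simp add: prob_space)
next
  case (insert p P)
  \<comment> \<open>Induction over the coordinates: \<open>c\<close> is a cylinder probability
    before the coordinate \<open>p\<close> is added, and \<open>c'\<close> refines it by the value
    \<open>s\<close> at \<open>p\<close>, so that summing over \<open>s\<close> restores
    \<open>c\<close>.\<close>
  define c where "c g y = prob {\<omega> \<in> space M. \<forall>q\<in>S g \<inter> P. Y q \<omega> = y q}" for g y
  define c' where "c' g y s = prob {\<omega> \<in> space M. Y p \<omega> = s \<and> (\<forall>q\<in>S g \<inter> P. Y q \<omega> = y q)}" for g y s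
  have [measurable]: "Measurable.pred M (\<lambda>\<omega>. \<forall>q\<in>S g \<inter> P. Y q \<omega> = y q)" for g y
    using insert.hyps(1) by (intro pred_intros_finite) auto
  have sum_c': "(\<Sum>s\<in>UNIV. c' g y s) = c g y" for g y
  proof -
    have "{\<omega> \<in> space M. \<forall>q\<in>S g \<inter> P. Y q \<omega> = y q} =
        (\<Union>s. {\<omega> \<in> space M. Y p \<omega> = s \<and> (\<forall>q\<in>S g \<inter> P. Y q \<omega> = y q)})" by auto
    then show ?thesis unfolding c_def c'_def
      by (simp only:) (intro finite_measure_finite_Union[symmetric]; force simp: disjoint_family_on_def)
  qed
  let ?G = "{g \<in> D. p \<in> S g}" and ?N = "{g \<in> D. p \<notin> S g}"
  have D_split: "(\<Prod>g\<in>D. w g) = (\<Prod>g\<in>?N. w g) * (\<Prod>g\<in>?G. w g)" for w :: "_ \<Rightarrow> real"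
  proof -
    have "D = ?N \<union> ?G" by auto
    then have "prod w D = prod w (?N \<union> ?G)" by simp
    also have "\<dots> = prod w ?N * prod w ?G" using D by (intro prod.union_disjoint) auto
    finally show ?thesis .
  qed
  \<comment> \<open>Only the factors whose set contains \<open>p\<close> feel the new value
    \<open>s\<close>. There are exactly \<open>m\<close> of them, the number of exponents that
    Holder's inequality in the variable \<open>s\<close> requires.\<close>
  have summand: "(\<Prod>g\<in>D. root m (prob {\<omega> \<in> space M. \<forall>q\<in>S g \<inter> insert p P. Y q \<omega> = (y(p := s)) q})) =
      (\<Prod>g\<in>?N. root m (c g y)) * (\<Prod>g\<in>?G. root m (c' g y s))" for y s
  proof -
    have "(\<forall>q\<in>S g \<inter> insert p P. Y q \<omega> = (y(p := s)) q) \<longleftrightarrow>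
        (p \<in> S g \<longrightarrow> Y p \<omega> = s) \<and> (\<forall>q\<in>S g \<inter> P. Y q \<omega> = y q)" for g \<omega>
      using insert.hyps(2) by auto
    then show ?thesis unfolding D_split c_def c'_def
      by (simp only:, intro arg_cong2[of _ _ _ _ "(*)"] prod.cong refl) simp_all
  qed
  have "(\<Sum>y\<in>insert p P \<rightarrow>\<^sub>E UNIV. \<Prod>g\<in>D. root m (prob {\<omega> \<in> space M. \<forall>q\<in>S g \<inter> insert p P. Y q \<omega> = y q})) =
      (\<Sum>(s, y)\<in>UNIV \<times> (P \<rightarrow>\<^sub>E UNIV). (\<Prod>g\<in>?N. root m (c g y)) * (\<Prod>g\<in>?G. root m (c' g y s)))"
    unfolding PiE_insert_eq sum.reindex[OF inj_combinator[OF insert.hyps(2), of "\<lambda>_. UNIV"]]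
    by (simp only: comp_def case_prod_unfold summand)
  also have "\<dots> = (\<Sum>y\<in>P \<rightarrow>\<^sub>E UNIV. (\<Prod>g\<in>?N. root m (c g y)) * (\<Sum>s\<in>UNIV. \<Prod>g\<in>?G. root m (c' g y s)))"
    unfolding sum.cartesian_product[symmetric] by (subst sum.swap) (simp add: sum_distrib_left)
  also have "\<dots> \<le> (\<Sum>y\<in>P \<rightarrow>\<^sub>E UNIV. (\<Prod>g\<in>?N. root m (c g y)) * (\<Prod>g\<in>?G. root m (\<Sum>s\<in>UNIV. c' g y s)))"
    by (intro sum_mono mult_left_mono generalized_Holder_sum insert.prems m prod_nonneg real_root_ge_zero)
      (auto simp: c_def c'_def)
  also have "\<dots> = (\<Sum>y\<in>P \<rightarrow>\<^sub>E UNIV. \<Prod>g\<in>D. root m (c g y))"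
    unfolding sum_c' D_split ..
  also have "\<dots> \<le> 1" unfolding c_def using insert.prems by (intro insert.IH) auto
  finally show ?case .
qed

section \<open>Patterns of the process and their number\<close>

lemma pattern_eq_iff:
  "pattern T X E \<omega> = pattern T X E \<omega>' \<longleftrightarrow> (\<forall>e\<in>E. X (T e \<omega>) = X (T e \<omega>'))"
  unfolding pattern_def fun_eq_iff by auto

lemma finite_patterns:
  fixes X :: "'w \<Rightarrow> 's::finite"
  assumes "finite E"
  shows "finite (pattern T X E ` A)"
proof (rule finite_subset)
  show "pattern T X E ` A \<subseteq> (\<lambda>y e. if e \<in> E then Some (y e) else None) ` (E \<rightarrow>\<^sub>E UNIV)"
  proof
    fix a assume "a \<in> pattern T X E ` A"
    then obtain \<omega> where "a = pattern T X E \<omega>" by blast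
    then have "a = (\<lambda>y e. if e \<in> E then Some (y e) else None) (restrict (\<lambda>e. X (T e \<omega>)) E)"
      by (auto simp: pattern_def)
    then show "a \<in> (\<lambda>y e. if e \<in> E then Some (y e) else None) ` (E \<rightarrow>\<^sub>E UNIV)"
      by (intro image_eqI[where x = "restrict (\<lambda>e. X (T e \<omega>)) E"]) simp_all
  qed
  show "finite ((\<lambda>y e. if e \<in> E then Some (y e) else None) ` (E \<rightarrow>\<^sub>E (UNIV :: 's set)))"
    by (intro finite_imageI finite_PiE assms finite)
qed

locale pmp_process = pmp_action M T for M :: "'w measure" and T :: "'g::{group_add, countable} \<Rightarrow> 'w \<Rightarrow> 'w" +
  fixes X :: "'w \<Rightarrow> 's::finite"
  assumes X_measurable [measurable]: "X \<in> measurable M (count_space UNIV)"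
begin

lemma pred_X_eq [measurable]:
  assumes [measurable]: "f \<in> measurable M M" "g \<in> measurable M M"
  shows "Measurable.pred M (\<lambda>\<omega>. X (f \<omega>) = X (g \<omega>))"
proof -
  have "Measurable.pred M (\<lambda>\<omega>. \<exists>s. X (f \<omega>) = s \<and> X (g \<omega>) = s)" by measurable
  then show ?thesis by simp
qed

lemma pattern_measurable:
  assumes "finite E"
  shows "pattern T X E \<in> measurable M (count_space (pattern T X E ` space M))"
proof (subst measurable_count_space_eq2[OF finite_patterns[OF assms]], intro conjI ballI)
  fix a assume "a \<in> pattern T X E ` space M"
  then obtain \<omega> where a: "a = pattern T X E \<omega>" by blast
  have "{\<omega>' \<in> space M. \<forall>e\<in>E. X (T e \<omega>') = X (T e \<omega>)} \<in> events" by measurable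
  also have "{\<omega>' \<in> space M. \<forall>e\<in>E. X (T e \<omega>') = X (T e \<omega>)} = pattern T X E -` {a} \<inter> space M"
    unfolding a by (auto simp: pattern_eq_iff)
  finally show "pattern T X E -` {a} \<inter> space M \<in> events" .
qed simp

lemma pred_pattern_eq [measurable]:
  assumes "finite E"
  shows "Measurable.pred M (\<lambda>\<omega>. pattern T X E \<omega> = a)"
proof (cases "a \<in> pattern T X E ` space M")
  case True
  have "pattern T X E -` {a} \<inter> space M \<in> events"
    by (rule measurable_sets[OF pattern_measurable[OF assms]]) (use True in simp)
  moreover have "pattern T X E -` {a} \<inter> space M = {\<omega> \<in> space M. pattern T X E \<omega> = a}" by auto
  ultimately show ?thesis by (simp add: pred_def)
next
  case False
  then have "{\<omega> \<in> space M. pattern T X E \<omega> = a} = {}" by auto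
  then show ?thesis unfolding pred_def by (simp only: sets.empty_sets)
qed

definition pattern_prob :: "'g set \<Rightarrow> 'w \<Rightarrow> real" where
  "pattern_prob E \<omega> = prob {\<omega>' \<in> space M. pattern T X E \<omega>' = pattern T X E \<omega>}"

text \<open>Invariance of the measure. It converts the cylinders over translates of \<open>E\<close>
  in Finner's inequality into one function evaluated along the orbit, to which the ergodic theorem
  can apply.\<close>

lemma pattern_prob_translate:
  assumes E: "finite E" and \<omega>: "\<omega> \<in> space M"
  shows "prob {\<omega>' \<in> space M. \<forall>p\<in>right_translate E g. X (T p \<omega>') = X (T p \<omega>)} = pattern_prob E (T g \<omega>)"
proof -
  have "(\<forall>p\<in>right_translate E g. X (T p \<omega>') = X (T p \<omega>)) \<longleftrightarrow>
      pattern T X E (T g \<omega>') = pattern T X E (T g \<omega>)" if "\<omega>' \<in> space M" for \<omega>'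
    unfolding right_translate_def pattern_eq_iff using T_add[OF that] T_add[OF \<omega>] by auto
  then have "{\<omega>' \<in> space M. \<forall>p\<in>right_translate E g. X (T p \<omega>') = X (T p \<omega>)} =
      {\<omega>' \<in> space M. pattern T X E (T g \<omega>') = pattern T X E (T g \<omega>)}" by auto
  moreover have "{\<omega>' \<in> space M. pattern T X E \<omega>' = pattern T X E (T g \<omega>)} \<in> events"
    using pred_pattern_eq[OF E] by (simp add: pred_def)
  ultimately show ?thesis unfolding pattern_prob_def
    using prob_T[of "\<lambda>\<omega>'. pattern T X E \<omega>' = pattern T X E (T g \<omega>)"] by simp
qed

text \<open>The translates of \<open>E\<close> that meet \<open>P\<close> cover every site of
  \<open>P\<close> exactly \<open>card E\<close> times. By Finner's inequality the weights
  \<open>r\<close> of all patterns on \<open>P\<close> sum to at most 1, while a typical pattern has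
  weight at least \<open>c\<close>.\<close>

lemma card_typical_patterns:
  assumes E: "finite E" "E \<noteq> {}" and P: "finite P" and A: "A \<subseteq> space M"
    and typical: "\<And>\<omega>. \<omega> \<in> A \<Longrightarrow>
      (\<Prod>g\<in>set_prod (set_inv E) P. root (card E) (pattern_prob E (T g \<omega>))) \<ge> c"
  shows "real (card (pattern T X P ` A)) * c \<le> 1"
proof -
  define D where "D = set_prod (set_inv E) P"
  \<comment> \<open>Patterns on \<open>P\<close> recoded as extensional functions, the index set of
    Finner's sum.\<close>
  define y where "y \<omega> = restrict (\<lambda>p. X (T p \<omega>)) P" for \<omega>
  define r where "r y = (\<Prod>g\<in>D. root (card E) (prob {\<omega>' \<in> space M. \<forall>p\<in>right_translate E g \<inter> P. X (T p \<omega>') = y p}))"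
    for y
  have finD: "finite D" unfolding D_def using E P by (intro finite_set_prod finite_set_inv)
  have m: "card E > 0" using E by (simp add: card_gt_0_iff)
  have cover: "card {g \<in> D. p \<in> right_translate E g} = card E" if "p \<in> P" for p
  proof -
    have "{g \<in> D. p \<in> right_translate E g} = (\<lambda>e. - e + p) ` E"
    proof (intro equalityI subsetI)
      fix g assume "g \<in> {g \<in> D. p \<in> right_translate E g}"
      then have "p - g \<in> E" by (simp add: right_translate_iff)
      moreover have "g = - (p - g) + p" by (simp add: algebra_simps)
      ultimately show "g \<in> (\<lambda>e. - e + p) ` E" by blast
    next
      fix g assume "g \<in> (\<lambda>e. - e + p) ` E"
      then obtain e where e: "e \<in> E" "g = - e + p" by blast
      then have "g \<in> D" unfolding D_def using that by (auto intro!: set_prodI simp: set_inv_def)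
      moreover have "p - g = e" using e by (simp add: algebra_simps)
      ultimately show "g \<in> {g \<in> D. p \<in> right_translate E g}" using e by (simp add: right_translate_iff)
    qed
    then show ?thesis by (simp add: card_image inj_on_def)
  qed
  have fin: "finite (P \<rightarrow>\<^sub>E (UNIV :: 's set))" using P by (intro finite_PiE) auto
  have ge: "c \<le> r (y \<omega>)" if "\<omega> \<in> A" for \<omega>
  proof -
    have "c \<le> (\<Prod>g\<in>D. root (card E) (pattern_prob E (T g \<omega>)))"
      unfolding D_def by (rule typical[OF that])
    also have "\<dots> \<le> r (y \<omega>)"
      unfolding r_def
    proof (intro prod_mono conjI)
      fix g assume "g \<in> D"
      show "0 \<le> root (card E) (pattern_prob E (T g \<omega>))" unfolding pattern_prob_def using m by simp
      have "pattern_prob E (T g \<omega>) = prob {\<omega>' \<in> space M. \<forall>p\<in>right_translate E g. X (T p \<omega>') = X (T p \<omega>)}"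
        using pattern_prob_translate[OF E(1)] that A by auto
      \<comment> \<open>A translate of \<open>E\<close> may stick out of \<open>P\<close>; dropping
        the outside sites enlarges the cylinder, which is the favourable direction.\<close>
      also have "\<dots> \<le> prob {\<omega>' \<in> space M. \<forall>p\<in>right_translate E g \<inter> P. X (T p \<omega>') = y \<omega> p}"
        using P by (intro finite_measure_mono) (auto simp: y_def)
      finally show "root (card E) (pattern_prob E (T g \<omega>)) \<le>
          root (card E) (prob {\<omega>' \<in> space M. \<forall>p\<in>right_translate E g \<inter> P. X (T p \<omega>') = y \<omega> p})"
        using m by simp
    qed
    finally show ?thesis .
  qed
  have "pattern T X P ` A = (\<lambda>z p. if p \<in> P then Some (z p) else None) ` y ` A"
    unfolding image_image by (intro image_cong refl ext) (auto simp: pattern_def y_def)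
  moreover have "finite (y ` A)" by (rule finite_subset[OF _ fin]) (auto simp: y_def)
  ultimately have card_le: "card (pattern T X P ` A) \<le> card (y ` A)" by (simp only: card_image_le)
  show ?thesis
  proof (cases "c \<ge> 0")
    case True
    have "real (card (pattern T X P ` A)) * c \<le> real (card (y ` A)) * c"
      using card_le True by (intro mult_right_mono) auto
    also have "\<dots> = (\<Sum>z\<in>y ` A. c)" by simp
    also have "\<dots> \<le> (\<Sum>z\<in>y ` A. r z)" using ge by (intro sum_mono) auto
    also have "\<dots> \<le> (\<Sum>z\<in>P \<rightarrow>\<^sub>E UNIV. r z)"
      using fin by (intro sum_mono2) (auto simp: y_def r_def intro!: prod_nonneg real_root_ge_zero)
    also have "\<dots> \<le> 1" unfolding r_def
      by (rule Finner_cylinders[where Y = "\<lambda>p \<omega>. X (T p \<omega>)", OF _ P finD m cover]) measurable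
    finally show ?thesis .
  next
    case False
    then have "real (card (pattern T X P ` A)) * c \<le> 0" by (simp add: mult_nonneg_nonpos)
    then show ?thesis by simp
  qed
qed

end

section \<open>Information and entropy of a pattern\<close>

context pmp_process
begin

lemma integral_pattern:
  fixes \<phi> :: "('g \<Rightarrow> 's option) \<Rightarrow> real"
  assumes "finite E"
  shows "(\<integral>\<omega>. \<phi> (pattern T X E \<omega>) \<partial>M) =
    (\<Sum>a\<in>pattern T X E ` space M. \<phi> a * prob {\<omega> \<in> space M. pattern T X E \<omega> = a})"
proof -
  let ?A = "pattern T X E ` space M" and ?S = "\<lambda>a. {\<omega> \<in> space M. pattern T X E \<omega> = a}"
  have S: "?S a \<in> events" for a using pred_pattern_eq[OF assms] by (simp add: pred_def)
  have "(\<integral>\<omega>. \<phi> (pattern T X E \<omega>) \<partial>M) = (\<integral>\<omega>. (\<Sum>a\<in>?A. \<phi> a * indicator (?S a) \<omega>) \<partial>M)"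
  proof (intro Bochner_Integration.integral_cong refl)
    fix \<omega> assume \<omega>: "\<omega> \<in> space M"
    have "(\<Sum>a\<in>?A. \<phi> a * indicator (?S a) \<omega>) = (\<Sum>a\<in>?A. if a = pattern T X E \<omega> then \<phi> a else 0)"
      using \<omega> by (intro sum.cong) (auto simp: indicator_def)
    then show "\<phi> (pattern T X E \<omega>) = (\<Sum>a\<in>?A. \<phi> a * indicator (?S a) \<omega>)"
      using \<omega> finite_patterns[OF assms, of T X "space M"] by simp
  qed
  also have "\<dots> = (\<Sum>a\<in>?A. \<integral>\<omega>. \<phi> a * indicator (?S a) \<omega> \<partial>M)"
    using S by (intro Bochner_Integration.integral_sum integrable_mult_right integrable_real_indicator)
      (auto simp: emeasure_eq_measure)
  also have "\<dots> = (\<Sum>a\<in>?A. \<phi> a * prob (?S a))" using S by simp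
  finally show ?thesis .
qed

text \<open>The Shannon information function. The value 0 for patterns of probability 0 concerns
  only a null set and fits the convention for \<open>p * log 2 p\<close> at
  \<open>p = 0\<close>.\<close>

definition pattern_info :: "'g set \<Rightarrow> 'w \<Rightarrow> real" where
  "pattern_info E \<omega> = (if pattern_prob E \<omega> > 0 then - log 2 (pattern_prob E \<omega>) else 0)"

lemma pattern_info_nonneg: "pattern_info E \<omega> \<ge> 0"
proof -
  have "log 2 (pattern_prob E \<omega>) \<le> 0" if "pattern_prob E \<omega> > 0"
    using that by (simp add: pattern_prob_def)
  then show ?thesis unfolding pattern_info_def by auto
qed

lemma pattern_info_measurable:
  assumes "finite E"
  shows "pattern_info E \<in> borel_measurable M"
proof -
  define q where "q a = prob {\<omega>' \<in> space M. pattern T X E \<omega>' = a}" for a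
  have "(\<lambda>a. if q a > 0 then - log 2 (q a) else 0) \<circ> pattern T X E \<in> borel_measurable M"
    by (rule measurable_comp[OF pattern_measurable[OF assms]]) simp
  then show ?thesis unfolding comp_def q_def pattern_info_def[abs_def] pattern_prob_def .
qed

lemma integral_pattern_info:
  assumes "finite E"
  shows "(\<integral>\<omega>. pattern_info E \<omega> \<partial>M) = block_entropy M T X E"
proof -
  define q where "q a = prob {\<omega>' \<in> space M. pattern T X E \<omega>' = a}" for a
  have "(\<integral>\<omega>. pattern_info E \<omega> \<partial>M) =
      (\<Sum>a\<in>pattern T X E ` space M. (if q a > 0 then - log 2 (q a) else 0) * q a)"
    using integral_pattern[OF assms, of "\<lambda>a. if q a > 0 then - log 2 (q a) else 0"]
    unfolding q_def pattern_info_def pattern_prob_def .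
  also have "\<dots> = (\<Sum>a\<in>pattern T X E ` space M. - (q a * log 2 (q a)))"
  proof (intro sum.cong refl)
    fix a
    have "q a \<ge> 0" unfolding q_def by simp
    then show "(if q a > 0 then - log 2 (q a) else 0) * q a = - (q a * log 2 (q a))" by auto
  qed
  also have "\<dots> = block_entropy M T X E"
    unfolding block_entropy_def Let_def q_def by (simp add: sum_negf)
  finally show ?thesis .
qed

text \<open>A finite shape over a finite alphabet has finitely many patterns. Boundedness is what
  the pointwise ergodic theorem asks for and what controls the boundary of
  \<open>F k\<close>.\<close>

lemma pattern_info_bounded:
  assumes "finite E"
  obtains B where "\<And>\<omega>. \<omega> \<in> space M \<Longrightarrow> pattern_info E \<omega> \<le> B"
proof -
  define \<phi> where "\<phi> a = (let q = prob {\<omega>' \<in> space M. pattern T X E \<omega>' = a} in if q > 0 then - log 2 q else 0)" for a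
  have \<phi>: "pattern_info E \<omega> = \<phi> (pattern T X E \<omega>)" for \<omega>
    unfolding \<phi>_def pattern_info_def pattern_prob_def Let_def by simp
  have "\<phi> (pattern T X E \<omega>) \<le> Max (\<phi> ` pattern T X E ` space M)" if "\<omega> \<in> space M" for \<omega>
    using that finite_patterns[OF assms] by (intro Max_ge) auto
  then show thesis using that \<phi> by metis
qed

lemma pattern_prob_pos:
  assumes E: "finite E"
  shows "AE \<omega> in M. pattern_prob E \<omega> > 0"
proof -
  have "AE \<omega> in M. \<forall>a\<in>pattern T X E ` space M.
      prob {\<omega>' \<in> space M. pattern T X E \<omega>' = a} = 0 \<longrightarrow> pattern T X E \<omega> \<noteq> a"
  proof (rule AE_finite_allI[OF finite_patterns[OF E]])
    fix a
    show "AE \<omega> in M. prob {\<omega>' \<in> space M. pattern T X E \<omega>' = a} = 0 \<longrightarrow> pattern T X E \<omega> \<noteq> a"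
    proof (cases "prob {\<omega>' \<in> space M. pattern T X E \<omega>' = a} = 0")
      case True
      then show ?thesis using pred_pattern_eq[OF E, of a]
        by (subst AE_iff_measurable[OF _ refl]) (auto simp: pred_def emeasure_eq_measure)
    qed simp
  qed
  then show ?thesis using AE_space
  proof eventually_elim
    case (elim \<omega>)
    then have "pattern_prob E \<omega> \<noteq> 0" unfolding pattern_prob_def by blast
    then show ?case unfolding pattern_prob_def by (simp add: zero_less_measure_iff)
  qed
qed

text \<open>Minus the logarithm of the product is the sum of the information over the sites, divided
  by \<open>card E\<close>. Up to a negligible boundary this is an ergodic sum over
  \<open>F k\<close>, so per site it tends to the entropy of \<open>E\<close> divided by
  \<open>card E\<close>, which is below \<open>b\<close>.\<close>

lemma eventually_typical:
  assumes erg: "ergodic_action M T" and F: "tempered_folner F"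
    and E: "finite E" "E \<noteq> {}" and b: "block_entropy M T X E / real (card E) < b"
  shows "AE \<omega> in M. \<forall>\<^sub>F k in sequentially.
    (\<Prod>g\<in>set_prod (set_inv E) (F k). root (card E) (pattern_prob E (T g \<omega>))) \<ge>
      2 powr (- b * real (card (F k)))"
proof -
  define m where "m = card E"
  have m: "m > 0" unfolding m_def using E by (simp add: card_gt_0_iff)
  have fol: "folner F" using F unfolding tempered_folner_def by simp
  obtain B where B: "\<And>\<omega>. \<omega> \<in> space M \<Longrightarrow> pattern_info E \<omega> \<le> B"
    using pattern_info_bounded[OF E(1)] by blast
  have absB: "\<bar>pattern_info E \<omega>\<bar> \<le> B" if "\<omega> \<in> space M" for \<omega>
    using B[OF that] pattern_info_nonneg[of E \<omega>] by simp
  let ?D = "\<lambda>k. set_prod (set_inv E) (F k)"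
  have "AE \<omega> in M. \<forall>g. pattern_prob E (T g \<omega>) > 0"
    unfolding AE_all_countable using AE_T[OF pattern_prob_pos[OF E(1)]] by blast
  moreover have "AE \<omega> in M. (\<lambda>k. avg F k (pattern_info E) \<omega>) \<longlonglongrightarrow> block_entropy M T X E"
    using pointwise_ergodic[OF erg F pattern_info_measurable[OF E(1)] absB]
    by (simp add: integral_pattern_info[OF E(1)])
  ultimately show ?thesis using AE_space
  proof eventually_elim
    case (elim \<omega>)
    \<comment> \<open>An upper bound for the exponent per site: the ergodic average over
      \<open>F k\<close>, plus the worst value \<open>B\<close> on those sites of
      \<open>?D k\<close> that lie outside \<open>F k\<close>.\<close>
    define r where "r k = (avg F k (pattern_info E) \<omega> +
        B * (real (card (?D k - F k)) / real (card (F k)))) / m" for k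
    have "r \<longlonglongrightarrow> (block_entropy M T X E + B * 0) / m"
      unfolding r_def using m
      by (intro tendsto_intros elim folner_set_prod_diff[OF fol] finite_set_inv E) simp
    then have "\<forall>\<^sub>F k in sequentially. r k < b"
      using b by (intro order_tendstoD(2)) (auto simp: m_def)
    then show ?case
    proof eventually_elim
      fix k assume rk: "r k < b"
      note finF = folnerD(1)[OF fol, of k] and posF = folnerD(3)[OF fol, of k]
      have finD: "finite (?D k)" using E finF by (intro finite_set_prod finite_set_inv)
      have "(\<Sum>g\<in>?D k. pattern_info E (T g \<omega>)) \<le>
          (\<Sum>g\<in>F k \<union> (?D k - F k). pattern_info E (T g \<omega>))"
        using finD finF pattern_info_nonneg by (intro sum_mono2) auto
      also have "\<dots> = (\<Sum>g\<in>F k. pattern_info E (T g \<omega>)) + (\<Sum>g\<in>?D k - F k. pattern_info E (T g \<omega>))"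
        using finD finF by (intro sum.union_disjoint) auto
      also have "(\<Sum>g\<in>?D k - F k. pattern_info E (T g \<omega>)) \<le> real (card (?D k - F k)) * B"
        using B T_space[OF \<open>\<omega> \<in> space M\<close>] by (intro sum_bounded_above) auto
      finally have "(\<Sum>g\<in>?D k. pattern_info E (T g \<omega>)) / m \<le>
          ((\<Sum>g\<in>F k. pattern_info E (T g \<omega>)) + real (card (?D k - F k)) * B) / m"
        by (intro divide_right_mono) auto
      also have "\<dots> = r k * real (card (F k))"
        using m posF unfolding r_def avg_def by (simp add: field_simps)
      also have "\<dots> \<le> b * real (card (F k))" using rk by (intro mult_right_mono) auto
      finally have le: "(\<Sum>g\<in>?D k. pattern_info E (T g \<omega>)) / m \<le> b * real (card (F k))" .
      \<comment> \<open>Positivity at every orbit point, valid almost surely because the group is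
        countable, keeps the default value of \<open>pattern_info\<close> out of play.\<close>
      have "root m (pattern_prob E (T g \<omega>)) = 2 powr (- pattern_info E (T g \<omega>) / m)" for g
      proof -
        have pos: "pattern_prob E (T g \<omega>) > 0" using elim by blast
        then have "pattern_prob E (T g \<omega>) = 2 powr (- pattern_info E (T g \<omega>))"
          unfolding pattern_info_def by simp
        then show ?thesis using m pos by (simp add: root_powr_inverse powr_powr)
      qed
      then have "(\<Prod>g\<in>?D k. root m (pattern_prob E (T g \<omega>))) =
          (\<Prod>g\<in>?D k. 2 powr (- pattern_info E (T g \<omega>) / m))" by simp
      also have "\<dots> = 2 powr (\<Sum>g\<in>?D k. - pattern_info E (T g \<omega>) / m)"
        using finD by (simp add: powr_sum)
      also have "\<dots> = 2 powr (- ((\<Sum>g\<in>?D k. pattern_info E (T g \<omega>)) / m))"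
        by (simp add: sum_negf sum_divide_distrib)
      finally show "2 powr (- b * real (card (F k))) \<le>
          (\<Prod>g\<in>?D k. root (card E) (pattern_prob E (T g \<omega>)))"
        using le unfolding m_def by simp
    qed
  qed
qed

section \<open>Small recurrence statistics are rare\<close>

text \<open>The singleton of 0 is always admissible, so the maximum is over a nonempty finite family
  and can be compared with a threshold set by set. This form yields measurability and can be tested
  on one chosen set.\<close>

lemma U_stat_less_iff:
  assumes W: "finite (W n)" "0 \<in> W n" and \<omega>: "\<omega> \<in> space M"
  shows "U_stat T X F W k n \<omega> < \<theta> \<longleftrightarrow>
    (\<forall>E\<in>Pow (W n). 0 \<in> E \<and> disjoint_family_on (right_translate (F k)) E \<longrightarrow>
      (\<forall>f\<in>E. repeats_at T X (F k) \<omega> f) \<longrightarrow> real (card E) < \<theta> * real (card (W n)))"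
proof -
  let ?V = "{E. 0 \<in> E \<and> E \<subseteq> W n \<and> disjoint_family_on (right_translate (F k)) E \<and>
      (\<forall>f\<in>E. repeats_at T X (F k) \<omega> f)}"
  have "?V \<subseteq> Pow (W n)" by auto
  then have fin: "finite ?V" using W(1) finite_subset by blast
  have "{0} \<in> ?V" using W \<omega> by (auto simp: repeats_at_def disjoint_family_on_def T_zero)
  then have ne: "?V \<noteq> {}" by blast
  have pos: "card (W n) > 0" using W by (auto simp: card_gt_0_iff)
  have "Max (card ` ?V) \<in> card ` ?V" using fin ne by (intro Max_in) auto
  then obtain E0 where E0: "Max (card ` ?V) = card E0" "E0 \<in> ?V" by (rule imageE)
  have le: "card E \<le> Max (card ` ?V)" if "E \<in> ?V" for E using fin that by (intro Max_ge) auto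
  have "real (Max (card ` ?V)) < \<theta> * real (card (W n)) \<longleftrightarrow>
      (\<forall>E\<in>?V. real (card E) < \<theta> * real (card (W n)))"
  proof (rule iffI)
    assume less: "real (Max (card ` ?V)) < \<theta> * real (card (W n))"
    show "\<forall>E\<in>?V. real (card E) < \<theta> * real (card (W n))"
      by (rule ballI) (rule le_less_trans[OF of_nat_mono[OF le] less])
  next
    assume "\<forall>E\<in>?V. real (card E) < \<theta> * real (card (W n))"
    from bspec[OF this E0(2)] show "real (Max (card ` ?V)) < \<theta> * real (card (W n))"
      unfolding E0(1) .
  qed
  moreover have "U_stat T X F W k n \<omega> < \<theta> \<longleftrightarrow> real (Max (card ` ?V)) < \<theta> * real (card (W n))"
    unfolding U_stat_def using pos by (simp add: image_Collect divide_less_eq)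
  ultimately show ?thesis by auto
qed

lemma U_stat_pred [measurable]:
  assumes W: "finite (W n)" "0 \<in> W n"
  shows "Measurable.pred M (\<lambda>\<omega>. U_stat T X F W k n \<omega> < \<theta>)"
proof -
  have rep: "Measurable.pred M (\<lambda>\<omega>. \<forall>f\<in>E. repeats_at T X (F k) \<omega> f)" for E
    unfolding repeats_at_def by measurable
  have "Measurable.pred M (\<lambda>\<omega>. \<forall>E\<in>Pow (W n). 0 \<in> E \<and> disjoint_family_on (right_translate (F k)) E \<longrightarrow>
      (\<forall>f\<in>E. repeats_at T X (F k) \<omega> f) \<longrightarrow> real (card E) < \<theta> * real (card (W n)))"
    using W(1) by (intro pred_intros_finite pred_intros_logic rep) auto
  then show ?thesis
    using U_stat_less_iff[of W n, OF W] by (subst measurable_cong) auto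
qed

text \<open>Along an orbit, bad points inside the window of a bad point are repetitions of the same
  pattern. After thinning to disjoint translates they compete in the statistic, so its smallness
  bounds their density in that window; filling globalises this, and transference with a constant
  function finishes. The cut-off \<open>N\<close> keeps the windows in a finite set.\<close>

lemma recurrence_bound_finite:
  assumes fol: "folner F" and W: "filling_with W C" and \<theta>: "\<theta> \<ge> 0"
  shows "prob {\<omega> \<in> space M. pattern T X (F k) \<omega> = a \<and> (\<exists>n\<le>N. U_stat T X F W k n \<omega> < \<theta>)}
    \<le> (real (card (F k)))\<^sup>2 * \<theta> / C"
proof -
  have C: "C > 0" and W0: "\<And>n. 0 \<in> W n" and finW: "\<And>n. finite (W n)"
    using W unfolding filling_with_def by auto
  note finF = folnerD(1)[OF fol, of k]
  note [measurable] = pred_pattern_eq[OF finF] U_stat_pred[OF finW W0]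
  define \<beta> where "\<beta> = (real (card (F k)))\<^sup>2 * \<theta>"
  have \<beta>: "\<beta> \<ge> 0" unfolding \<beta>_def using \<theta> by simp
  let ?P = "\<lambda>\<omega>. pattern T X (F k) \<omega> = a \<and> (\<exists>n\<le>N. U_stat T X F W k n \<omega> < \<theta>)"
  have "prob {\<omega> \<in> space M. ?P \<omega>} \<le> (\<integral>\<omega>. \<beta> / C \<partial>M)"
  proof (rule transference[OF fol, of "\<Union>n\<le>N. W n"])
    show "Measurable.pred M ?P" by measurable
    fix \<omega> and A :: "'g set" assume \<omega>: "\<omega> \<in> space M" and A: "finite A"
    define S where "S = {g \<in> A. ?P (T g \<omega>)}"
    have "\<forall>g\<in>S. \<exists>n. n \<le> N \<and> U_stat T X F W k n (T g \<omega>) < \<theta>" unfolding S_def by blast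
    then obtain n where n: "\<And>g. g \<in> S \<Longrightarrow> n g \<le> N" "\<And>g. g \<in> S \<Longrightarrow> U_stat T X F W k (n g) (T g \<omega>) < \<theta>"
      using bchoice[of S "\<lambda>g n. n \<le> N \<and> U_stat T X F W k n (T g \<omega>) < \<theta>"] by blast
    let ?D = "set_prod (\<Union>n\<le>N. W n) A"
    have "real (card S) \<le> \<beta> / C * real (card ?D)"
    proof (rule filling_card_le[OF W _ \<beta>, where n = n])
      show "finite S" using A unfolding S_def by simp
      show "finite ?D" using A finW by (intro finite_set_prod) auto
      fix g assume g: "g \<in> S"
      show "right_translate (W (n g)) g \<subseteq> ?D"
        using n(1)[OF g] g unfolding right_translate_def S_def
        by (auto intro!: set_prodI UN_I[of "n g"])
      \<comment> \<open>The bad points in the window of \<open>g\<close>, seen from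
        \<open>g\<close>. All carry the pattern \<open>a\<close>, as does \<open>g\<close> itself,
        so each is a repetition for \<open>T g \<omega>\<close>; thinning costs the factor
        \<open>(card (F k))\<^sup>2\<close> in \<open>\<beta>\<close>.\<close>
      define E where "E = {e \<in> W (n g). e + g \<in> S}"
      have E: "finite E" "0 \<in> E" unfolding E_def using finW W0 g by auto
      obtain E' where E': "E' \<subseteq> E" "0 \<in> E'" "disjoint_family_on (right_translate (F k)) E'"
        "card E \<le> (card (F k))\<^sup>2 * card E'"
        using disjoint_translates_subset[OF finF folnerD(2)[OF fol] E] by blast
      have "\<forall>f\<in>E'. repeats_at T X (F k) (T g \<omega>) f"
      proof
        fix f assume "f \<in> E'"
        then have "f + g \<in> S" using E'(1) unfolding E_def by blast
        then have "pattern T X (F k) (T (f + g) \<omega>) = pattern T X (F k) (T g \<omega>)"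
          using g unfolding S_def by simp
        then show "repeats_at T X (F k) (T g \<omega>) f"
          unfolding pattern_eq_iff repeats_at_def T_add[OF \<omega>] .
      qed
      moreover have "E' \<in> Pow (W (n g))" using E'(1) unfolding E_def by blast
      ultimately have "real (card E') < \<theta> * real (card (W (n g)))"
        using n(2)[OF g] E' U_stat_less_iff[of W "n g" "T g \<omega>" F k \<theta>] finW W0 T_space[OF \<omega>] by blast
      then have "(real (card (F k)))\<^sup>2 * real (card E') \<le> (real (card (F k)))\<^sup>2 * (\<theta> * real (card (W (n g))))"
        by (intro mult_left_mono) auto
      moreover have "real (card E) \<le> (real (card (F k)))\<^sup>2 * real (card E')"
        using E'(4) by (metis of_nat_le_iff of_nat_mult of_nat_power)
      moreover have "card (S \<inter> right_translate (W (n g)) g) = card E"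
      proof -
        have "S \<inter> right_translate (W (n g)) g = (\<lambda>e. e + g) ` E"
          unfolding E_def right_translate_def by auto
        then show ?thesis by (simp add: card_image inj_on_def)
      qed
      ultimately show "real (card (S \<inter> right_translate (W (n g)) g)) \<le> \<beta> * real (card (W (n g)))"
        unfolding \<beta>_def by (simp add: mult.assoc)
    qed
    then show "real (card {g \<in> A. ?P (T g \<omega>)}) \<le> (\<Sum>g\<in>?D. \<beta> / C)"
      unfolding S_def by (simp add: mult.commute)
  qed (use finW \<beta> C in auto)
  then show ?thesis unfolding \<beta>_def by (simp add: prob_space)
qed

lemma recurrence_bound:
  assumes fol: "folner F" and W: "filling_with W C" and \<theta>: "\<theta> \<ge> 0"
  shows "prob {\<omega> \<in> space M. pattern T X (F k) \<omega> = a \<and> (\<exists>n. U_stat T X F W k n \<omega> < \<theta>)}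
    \<le> (real (card (F k)))\<^sup>2 * \<theta> / C"
proof (rule LIMSEQ_le_const2)
  have W0: "\<And>n. 0 \<in> W n" and finW: "\<And>n. finite (W n)"
    using W unfolding filling_with_def by auto
  note [measurable] = pred_pattern_eq[OF folnerD(1)[OF fol]] U_stat_pred[OF finW W0]
  let ?A = "\<lambda>N. {\<omega> \<in> space M. pattern T X (F k) \<omega> = a \<and> (\<exists>n\<le>N. U_stat T X F W k n \<omega> < \<theta>)}"
  have "(\<lambda>N. prob (?A N)) \<longlonglongrightarrow> prob (\<Union>N. ?A N)"
  proof (rule finite_Lim_measure_incseq)
    show "range ?A \<subseteq> events" by (auto simp del: ex_simps) 
    show "incseq ?A" by (auto simp: incseq_def intro: order_trans)
  qed
  also have "(\<Union>N. ?A N) = {\<omega> \<in> space M. pattern T X (F k) \<omega> = a \<and> (\<exists>n. U_stat T X F W k n \<omega> < \<theta>)}"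
    by auto
  finally show "(\<lambda>N. prob (?A N)) \<longlonglongrightarrow>
    prob {\<omega> \<in> space M. pattern T X (F k) \<omega> = a \<and> (\<exists>n. U_stat T X F W k n \<omega> < \<theta>)}" .
  show "\<exists>N. \<forall>n\<ge>N. prob (?A n) \<le> (real (card (F k)))\<^sup>2 * \<theta> / C"
    using recurrence_bound_finite[OF assms] by blast
qed

text \<open>About \<open>2 powr ((h + \<delta> / 3) * card (F k))\<close> typical patterns, each
  with a bad part of probability at most a constant times \<open>(card (F k))\<^sup>2 * 2 powr (- (h
  + \<delta>) * card (F k))\<close>, leave a summable total.\<close>

lemma eventually_U_stat_ge:
  assumes erg: "ergodic_action M T" and F: "tempered_folner F" and card_F: "\<And>n. card (F n) \<ge> n"
    and W: "filling_with W C" and \<delta>: "\<delta> > 0"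
    and h: "(\<lambda>k. block_entropy M T X (F k) / real (card (F k))) \<longlonglongrightarrow> h"
  shows "AE \<omega> in M. \<forall>\<^sub>F k in sequentially. \<forall>n.
    U_stat T X F W k n \<omega> \<ge> 2 powr (- (h + \<delta>) * real (card (F k)))"
proof -
  have fol: "folner F" using F unfolding tempered_folner_def by simp
  have C: "C > 0" and W0: "\<And>n. 0 \<in> W n" and finW: "\<And>n. finite (W n)"
    using W unfolding filling_with_def by auto
  \<comment> \<open>One third of the slack pays for the number of patterns; two thirds remain as
    exponential decay.\<close>
  define b where "b = h + \<delta> / 3"
  have "h < b" unfolding b_def using \<delta> by simp
  from order_tendstoD(2)[OF h this] obtain j
    where j: "block_entropy M T X (F j) / real (card (F j)) < b"
    using eventually_happens by force
  \<comment> \<open>The shape is fixed once and for all while \<open>k\<close> grows; any index with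
    normalised entropy below \<open>b\<close> will do.\<close>
  define E where "E = F j"
  have E: "finite E" "E \<noteq> {}" unfolding E_def using folnerD[OF fol] by auto
  define c where "c k = real (card (F k))" for k
  define typical where "typical k = {\<omega> \<in> space M.
    (\<Prod>g\<in>set_prod (set_inv E) (F k). root (card E) (pattern_prob E (T g \<omega>))) \<ge> 2 powr (- b * c k)}" for k
  define \<theta> where "\<theta> k = 2 powr (- (h + \<delta>) * c k)" for k
  define R where "R a k = {\<omega> \<in> space M. pattern T X (F k) \<omega> = a \<and> (\<exists>n. U_stat T X F W k n \<omega> < \<theta> k)}" for a k
  \<comment> \<open>The union runs over patterns realised by typical points, so a typical point
    outside \<open>Z k\<close> cannot have a small statistic at stage \<open>k\<close>.\<close>
  define Z where "Z k = (\<Union>a\<in>pattern T X (F k) ` typical k. R a k)" for k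
  have R: "R a k \<in> events" for a k
  proof -
    note [measurable] = pred_pattern_eq[OF folnerD(1)[OF fol]] U_stat_pred[OF finW W0]
    show ?thesis unfolding R_def by measurable
  qed
  have fin: "finite (pattern T X (F k) ` typical k)" for k
    by (intro finite_patterns folnerD(1)[OF fol])
  then have Z: "Z k \<in> events" for k unfolding Z_def using R by (intro sets.finite_UN) auto
  have prob_Z: "prob (Z k) \<le> (c k)\<^sup>2 * 2 powr (- (2 * \<delta> / 3) * c k) / C" for k
  proof -
    have "real (card (pattern T X (F k) ` typical k)) * 2 powr (- b * c k) \<le> 1"
      by (rule card_typical_patterns[OF E folnerD(1)[OF fol]]) (auto simp: typical_def)
    then have card_le: "real (card (pattern T X (F k) ` typical k)) \<le> 2 powr (b * c k)"
      by (simp add: powr_minus field_simps)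
    have "prob (Z k) \<le> (\<Sum>a\<in>pattern T X (F k) ` typical k. prob (R a k))"
      unfolding Z_def using fin R by (intro finite_measure_subadditive_finite) auto
    also have "\<dots> \<le> (\<Sum>a\<in>pattern T X (F k) ` typical k. (c k)\<^sup>2 * \<theta> k / C)"
      unfolding R_def c_def using recurrence_bound[OF fol W] by (intro sum_mono) (simp add: \<theta>_def)
    also have "\<dots> = real (card (pattern T X (F k) ` typical k)) * ((c k)\<^sup>2 * \<theta> k / C)" by simp
    also have "\<dots> \<le> 2 powr (b * c k) * ((c k)\<^sup>2 * \<theta> k / C)"
      using card_le C by (intro mult_right_mono) (auto simp: \<theta>_def)
    also have "\<dots> = (c k)\<^sup>2 * (2 powr (b * c k) * \<theta> k) / C" by simp
    also have "2 powr (b * c k) * \<theta> k = 2 powr (- (2 * \<delta> / 3) * c k)"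
      unfolding \<theta>_def b_def powr_add[symmetric] by (simp add: algebra_simps)
    finally show ?thesis .
  qed
  have "summable (\<lambda>k. prob (Z k))"
  proof (rule summable_comparison_test_ev)
    \<comment> \<open>Half of the remaining decay absorbs the quadratic factor. The other half is
      dominated by a geometric series in \<open>k\<close>, because
      \<open>card (F k) \<ge> k\<close>; the same inequality lets the threshold \<open>N\<close> be
      applied to \<open>card (F k)\<close>.\<close>
    have "(\<lambda>n. (real n)\<^sup>2 * 2 powr (- (\<delta> / 3) * real n)) \<longlonglongrightarrow> 0" using \<delta> by real_asymp
    then have "\<forall>\<^sub>F n in sequentially. (real n)\<^sup>2 * 2 powr (- (\<delta> / 3) * real n) < 1"
      by (rule order_tendstoD) simp
    then obtain N where N: "\<And>n. n \<ge> N \<Longrightarrow> (real n)\<^sup>2 * 2 powr (- (\<delta> / 3) * real n) < 1"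
      unfolding eventually_sequentially by blast
    show "\<forall>\<^sub>F k in sequentially. norm (prob (Z k)) \<le> (2 powr (- (\<delta> / 3))) ^ k / C"
      unfolding eventually_sequentially
    proof (intro exI[of _ N] allI impI)
      fix k assume k: "k \<ge> N"
      have "(c k)\<^sup>2 * 2 powr (- (2 * \<delta> / 3) * c k) =
          ((c k)\<^sup>2 * 2 powr (- (\<delta> / 3) * c k)) * 2 powr (- (\<delta> / 3) * c k)"
      proof -
        have "- (2 * \<delta> / 3) * c k = - (\<delta> / 3) * c k + - (\<delta> / 3) * c k" by (simp add: field_simps)
        then show ?thesis by (simp only: powr_add mult.assoc)
      qed
      also have "\<dots> \<le> 1 * 2 powr (- (\<delta> / 3) * c k)"
        unfolding c_def using N[of "card (F k)"] card_F[of k] k by (intro mult_right_mono) auto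
      also have "\<dots> \<le> 2 powr (- (\<delta> / 3) * real k)"
        unfolding c_def using card_F[of k] \<delta> by simp
      also have "\<dots> = (2 powr (- (\<delta> / 3))) ^ k"
        by (simp add: powr_realpow[symmetric] powr_powr)
      finally show "norm (prob (Z k)) \<le> (2 powr (- (\<delta> / 3))) ^ k / C"
        using prob_Z[of k] C by (simp add: divide_right_mono order_trans)
    qed
    show "summable (\<lambda>k. (2 powr (- (\<delta> / 3))) ^ k / C)"
      using \<delta> by (intro summable_divide summable_geometric) (simp add: powr_less_one)
  qed
  then have "AE \<omega> in M. \<forall>\<^sub>F k in sequentially. \<omega> \<in> space M - Z k"
    by (intro borel_cantelli_AE1 Z) (auto simp: emeasure_eq_measure)
  moreover have "AE \<omega> in M. \<forall>\<^sub>F k in sequentially.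
    (\<Prod>g\<in>set_prod (set_inv E) (F k). root (card E) (pattern_prob E (T g \<omega>))) \<ge> 2 powr (- b * c k)"
    unfolding c_def using j by (intro eventually_typical[OF erg F E]) (simp add: E_def)
  ultimately show ?thesis using AE_space
  proof eventually_elim
    case (elim \<omega>)
    from elim(1,2) show ?case
    proof eventually_elim
      case (elim k)
      then have "\<omega> \<in> typical k" using \<open>\<omega> \<in> space M\<close> unfolding typical_def by simp
      then have "\<omega> \<notin> R (pattern T X (F k) \<omega>) k" using elim unfolding Z_def by blast
      then show ?case using \<open>\<omega> \<in> space M\<close> unfolding R_def \<theta>_def c_def by (auto simp: not_less)
    qed
  qed
qed

end

theorem theorem1p8:
  fixes M :: "'w::polish_space measure"
    and T :: "'g::{group_add, countable} \<Rightarrow> 'w \<Rightarrow> 'w"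
    and X :: "'w \<Rightarrow> 's::finite"
    and F W :: "nat \<Rightarrow> 'g set"
    and h :: real
  assumes "amenable_group TYPE('g)"
    and "prob_space M" and "sets M = sets borel"
    and "mp_action M T" and "free_action M T" and "ergodic_action M T"
    and "X \<in> measurable M (count_space UNIV)"
    and "(\<lambda>k. block_entropy M T X (F k) / real (card (F k))) \<longlonglongrightarrow> h"
    and "tempered_folner F" and "\<forall>n. card (F n) \<ge> n"
    and "filling W"
  shows "AE \<omega> in M.
           limsup (\<lambda>k. SUP n. ereal (- log 2 (U_stat T X F W k n \<omega>) / real (card (F k))))
             \<le> ereal h"
proof -
  interpret pmp_process M T X
    using assms by (intro pmp_process.intro pmp_action.intro pmp_action_axioms.intro pmp_process_axioms.intro)
  from assms(11) obtain C where W: "filling_with W C" unfolding filling_def by blast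
  have pos: "card (F k) > 0" for k
    using assms(9) folnerD(3) unfolding tempered_folner_def by blast
  let ?L = "\<lambda>\<omega>. limsup (\<lambda>k. SUP n. ereal (- log 2 (U_stat T X F W k n \<omega>) / real (card (F k))))"
  \<comment> \<open>Slacks \<open>1 / (i + 1)\<close> suffice, so only countably many exceptional
    null sets have to be discarded before the slack tends to 0.\<close>
  have "AE \<omega> in M. ?L \<omega> \<le> ereal (h + inverse (real (Suc i)))" for i
  proof -
    let ?d = "inverse (real (Suc i))"
    have "AE \<omega> in M. \<forall>\<^sub>F k in sequentially. \<forall>n.
        U_stat T X F W k n \<omega> \<ge> 2 powr (- (h + ?d) * real (card (F k)))"
      using assms(6,8,9,10) W by (intro eventually_U_stat_ge) auto
    then show ?thesis
    proof eventually_elim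
      case (elim \<omega>)
      then have "\<forall>\<^sub>F k in sequentially.
          (SUP n. ereal (- log 2 (U_stat T X F W k n \<omega>) / real (card (F k)))) \<le> ereal (h + ?d)"
      proof eventually_elim
        case (elim k)
        show ?case
        proof (rule SUP_least)
          fix n
          have "log 2 (2 powr (- (h + ?d) * real (card (F k)))) \<le> log 2 (U_stat T X F W k n \<omega>)"
            using elim by (intro log_mono) auto
          then have "- log 2 (U_stat T X F W k n \<omega>) \<le> (h + ?d) * real (card (F k))"
            by (simp add: algebra_simps)
          then have "- log 2 (U_stat T X F W k n \<omega>) / real (card (F k)) \<le> h + ?d"
            using pos[of k] by (subst pos_divide_le_eq) auto
          then show "ereal (- log 2 (U_stat T X F W k n \<omega>) / real (card (F k))) \<le> ereal (h + ?d)" by simp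
        qed
      qed
      then show ?case by (rule Limsup_bounded)
    qed
  qed
  then have "AE \<omega> in M. \<forall>i. ?L \<omega> \<le> ereal (h + inverse (real (Suc i)))"
    by (subst AE_all_countable) simp
  then show ?thesis
  proof eventually_elim
    case (elim \<omega>)
    have "(\<lambda>i. h + inverse (real (Suc i))) \<longlonglongrightarrow> h + 0"
      by (intro tendsto_intros LIMSEQ_inverse_real_of_nat)
    then have lim: "(\<lambda>i. ereal (h + inverse (real (Suc i)))) \<longlonglongrightarrow> ereal h" by simp
    show ?case by (rule LIMSEQ_le_const[OF lim]) (use elim in blast)
  qed
qed

end
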